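(* Let $\mathcal{P},\mathcal{N}\subset\mathbb{Z}_{\ge 0}^2$ be finite disjoint sets, let $A$ be the set of P-positions of the altered Wythoff game with alteration sets $(\mathcal{P},\mathcal{N})$, and let $B$ be the set of P-positions of the unaltered Wythoff game. Then there exists a unique integer vector $(\Delta x,\Delta y)\in\mathbb{Z}^2$ such that $A_{(\Delta x,\Delta y)}$ is asymptotically equal to $B$.
   Context: Wythoff's game: a position is a pair $(x,y)$ of non-negative integers (two pile sizes). A move from $(x,y)$ goes to $(x-k,y)$, $(x,y-k)$ or $(x-k,y-k)$ for some integer $k\ge 1$, provided the resulting coordinates are non-negative. An altered Wythoff game is given by two finite disjoint sets $\mathcal{P},\mathcal{N}\subset\mathbb{Z}_{\ge0}^2$; its positions are labelled P or N by recursion on $x+y$: positions in $\mathcal{P}$ are labelled P, positions in $\mathcal{N}$ are labelled N, and any other position is labelled P if no position reachable from it in one move is labelled P, and N otherwise. Its set of P-positions is the set of positions labelled P. The unaltered game is the case $\mathcal{P}=\mathcal{N}=\emptyset$; its set of P-positions is $B=\{(\lfloor\phi n\rfloor,\lfloor\phi^2 n\rfloor):n\ge0\}\cup\{(\lfloor\phi^2 n\rfloor,\lfloor\phi n\rfloor):n\ge0\}$ with $\phi=(1+\sqrt5)/2$. For $S\subseteq\mathbb{Z}^2$, $S_{(\Delta x,\Delta y)}=\{(x+\Delta x,y+\Delta y):(x,y)\in S\}$. With $B_n=\{(x,y)\in\mathbb{Z}^2: x^2+y^2\le n^2\}$, two infinite sets $S,T\subseteq\mathbb{Z}^2$ are asymptotically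 equal if $\lim_{n\to\infty}\frac{|(S\cap T)\cap B_n|}{|(S\cup T)\cap B_n|}=1$. *)

theory Defs
  imports Complex_Main
begin

definition wythoff_move :: "nat \<times> nat \<Rightarrow> nat \<times> nat \<Rightarrow> bool" where
  "wythoff_move p q \<longleftrightarrow>
     (\<exists>x y k. p = (x, y) \<and> k \<ge> 1 \<and>
        (k \<le> x \<and> q = (x - k, y) \<or>
         k \<le> y \<and> q = (x, y - k) \<or>
         k \<le> x \<and> k \<le> y \<and> q = (x - k, y - k)))"

lemma wythoff_move_sum_less:
  "wythoff_move p q \<Longrightarrow> fst q + snd q < fst p + snd p"
  by (auto simp: wythoff_move_def)

text \<open>
  The predicate holds of exactly the positions labelled P; all others are labelled N.
  The alteration sets \<open>\<P>\<close>, \<open>\<N>\<close> are assumed to be disjoint wherever they are used,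
  so the order of the two membership tests is immaterial.
\<close>

function labelled_P :: "(nat \<times> nat) set \<Rightarrow> (nat \<times> nat) set \<Rightarrow> nat \<times> nat \<Rightarrow> bool" where
  "labelled_P \<P> \<N> p \<longleftrightarrow>
     (if p \<in> \<P> then True
      else if p \<in> \<N> then False
      else \<forall>q \<in> {q. wythoff_move p q}. \<not> labelled_P \<P> \<N> q)"
  by pat_completeness auto
termination
  by (relation "measure (\<lambda>(\<P>, \<N>, p). fst p + snd p)")
     (auto dest: wythoff_move_sum_less)

declare labelled_P.simps [simp del]

text \<open>The P-positions are regarded as points of the integer plane, where translation lives.\<close>

definition P_positions :: "(nat \<times> nat) set \<Rightarrow> (nat \<times> nat) set \<Rightarrow> (int \<times> int) set" where
  "P_positions \<P> \<N> = {(int x, int y) | x y. labelled_P \<P> \<N> (x, y)}"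

definition translate :: "(int \<times> int) set \<Rightarrow> int \<times> int \<Rightarrow> (int \<times> int) set" where
  "translate S d = {(x + fst d, y + snd d) | x y. (x, y) \<in> S}"

definition lattice_disc :: "nat \<Rightarrow> (int \<times> int) set" where
  "lattice_disc n = {(x, y). x\<^sup>2 + y\<^sup>2 \<le> (int n)\<^sup>2}"

text \<open>
  The quotient below may be \<open>0 / 0 = 0\<close>, but for infinite \<open>S\<close>, \<open>T\<close> only for
  finitely many \<open>n\<close>, so the limit is unaffected.
\<close>

definition asymptotically_equal :: "(int \<times> int) set \<Rightarrow> (int \<times> int) set \<Rightarrow> bool" where
  "asymptotically_equal S T \<longleftrightarrow>
     infinite S \<and> infinite T \<and>
     (\<lambda>n. real (card ((S \<inter> T) \<inter> lattice_disc n)) / real (card ((S \<union> T) \<inter> lattice_disc n)))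
       \<longlonglongrightarrow> 1"

end

theory Submission
  imports Defs
begin

text \<open>
  Far from the alteration sets every row and column contains exactly one P-position, and every
  diagonal at most one. Scanning the columns from left to right, call a positive difference \<open>y - x\<close>
  a hole if it is unused but smaller than some used one. No new holes arise, and each hole is filled
  in the end; hence from some point on the differences above the diagonal are taken in increasing
  order, and so are those below it. Thus up to finitely many points the P-positions are
  \<open>(a n, a n + n)\<close> and \<open>(c n + n, c n)\<close>, where the ranges of \<open>a n\<close> and \<open>c n + n\<close> partition the large
  integers, and so do those of \<open>c n\<close> and \<open>a n + n\<close>.

  The partitions leave two integer constants free, which a translation by \<open>(\<Delta>x, \<Delta>y)\<close> shifts
  by \<open>\<Delta>x\<close> and \<open>\<Delta>y\<close>; this determines the vector. When the constants of two such systems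
  agree, the total distance between them up to level \<open>N\<close> is bounded, up to a constant, by that up to
  level about \<open>2 N / 3\<close>. So it is \<open>o(N)\<close>, while the number of P-positions grows linearly.
\<close>

subsection \<open>Complementary sequences\<close>

definition cnt :: "(int \<Rightarrow> int) \<Rightarrow> int \<Rightarrow> int \<Rightarrow> nat" where
  "cnt f p t = card {n. p \<le> n \<and> f n \<le> t}"

lemma strict_mono_on_int_diff:
  fixes f :: "int \<Rightarrow> int"
  assumes "strict_mono_on {p..} f" "p \<le> m" "m \<le> n"
  shows "f m + (n - m) \<le> f n"
  using assms(3)
proof (induction n rule: int_ge_induct)
  case (step i)
  then have "f i < f (i + 1)"
    using assms(2) by (intro strict_mono_onD[OF assms(1)]) auto
  with step show ?case by simp
qed simp

lemma strict_mono_on_add_id: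
  fixes f :: "int \<Rightarrow> int"
  assumes "strict_mono_on {p..} f"
  shows "strict_mono_on {p..} (\<lambda>n. f n + n)"
  using assms by (auto intro!: strict_mono_onI add_strict_mono dest: strict_mono_onD)

text \<open>The labels counted form an initial segment of \<open>{p..}\<close>, so comparing values
  with a level becomes comparing labels with a threshold.\<close>

lemma less_cnt_iff:
  assumes "strict_mono_on {p..} f" "p \<le> n"
  shows "f n \<le> t \<longleftrightarrow> n < p + int (cnt f p t)"
proof -
  let ?A = "{n. p \<le> n \<and> f n \<le> t}"
  have bound: "n \<le> p + (t - f p)" if "n \<in> ?A" for n
    using strict_mono_on_int_diff[OF assms(1) order.refl, of n] that by auto
  have fin: "finite ?A"
    by (rule finite_subset[of _ "{p..p + (t - f p)}"]) (use bound in auto)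
  show ?thesis
  proof (cases "?A = {}")
    case True
    then have "cnt f p t = 0" "\<not> f n \<le> t"
      using assms(2) by (simp_all only: cnt_def card.empty) blast
    then show ?thesis using assms(2) by simp
  next
    case False
    define M where "M = Max ?A"
    have M: "M \<in> ?A" using fin False unfolding M_def by (rule Max_in)
    have "?A = {p..M}"
    proof (intro equalityI subsetI)
      fix k assume "k \<in> ?A"
      then show "k \<in> {p..M}" using fin by (auto simp: M_def)
    next
      fix k assume "k \<in> {p..M}"
      then show "k \<in> ?A"
        using strict_mono_on_int_diff[OF assms(1), of k M] M by auto
    qed
    then have "p + int (cnt f p t) = M + 1" "\<forall>k. k \<in> ?A \<longleftrightarrow> k \<in> {p..M}"
      using M by (auto simp: cnt_def)
    then show ?thesis using assms(2) by auto
  qed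
qed

text \<open>Because of \<open>f p' \<le> t\<close>, every dropped label was counted, so the count
  loses exactly \<open>p' - p\<close>.\<close>

lemma cnt_raise:
  assumes "strict_mono_on {p..} f" "p \<le> p'" "f p' \<le> t"
  shows "p' + int (cnt f p' t) = p + int (cnt f p t)"
proof -
  have sm': "strict_mono_on {p'..} f"
    using assms(1,2) by (auto intro: monotone_on_subset)
  have *: "n < p' + int (cnt f p' t) \<longleftrightarrow> n < p + int (cnt f p t)" if "p' \<le> n" for n
    using less_cnt_iff[OF sm' that] less_cnt_iff[OF assms(1), of n] that assms(2) by simp
  have "p' < p + int (cnt f p t)"
    using less_cnt_iff[OF assms(1,2)] assms(3) by simp
  \<comment> \<open>Two thresholds not below \<open>p'\<close> that cut off the same labels
    coincide; each is tested against the other.\<close>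
  then show ?thesis
    using *[of "p' + int (cnt f p' t)"] *[of "p + int (cnt f p t)"] by simp
qed

lemma cnt_shift: "cnt (\<lambda>n. f (n - k) + d) (p + k) t = cnt f p (t - d)"
proof -
  have "bij_betw (\<lambda>n. n + k) {n. p \<le> n \<and> f n \<le> t - d} {n. p + k \<le> n \<and> f (n - k) + d \<le> t}"
    by (rule bij_betw_byWitness[where f' = "\<lambda>n. n - k"]) auto
  then show ?thesis
    unfolding cnt_def by (simp add: bij_betw_same_card)
qed

text \<open>With labels \<open>n\<close> starting at \<open>p\<close>, the number \<open>p + cnt f p t\<close> is the first label \<open>n\<close> with
  \<open>t < f n\<close>. It depends on \<open>p\<close> only for small \<open>t\<close>, so \<open>r\<close> does not depend on the starting labels.\<close>

definition half :: "(int \<Rightarrow> int) \<Rightarrow> (int \<Rightarrow> int) \<Rightarrow> int \<Rightarrow> int \<Rightarrow> int \<Rightarrow> bool" where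
  "half a c p q r \<longleftrightarrow> strict_mono_on {p..} a \<and> strict_mono_on {q..} c \<and>
     (\<exists>t0. \<forall>t\<ge>t0. (p + int (cnt a p t)) + (q + int (cnt (\<lambda>n. c n + n) q t)) = t + r)"

lemma half_raise:
  assumes "half a c p q r" "p \<le> p'" "q \<le> q'"
  shows "half a c p' q' r"
proof -
  from assms(1) obtain t0 where sm: "strict_mono_on {p..} a" "strict_mono_on {q..} c"
    and t0: "\<And>t. t \<ge> t0 \<Longrightarrow> (p + int (cnt a p t)) + (q + int (cnt (\<lambda>n. c n + n) q t)) = t + r"
    by (auto simp: half_def)
  show ?thesis unfolding half_def
  proof (intro conjI exI allI impI)
    show "strict_mono_on {p'..} a" "strict_mono_on {q'..} c"
      using sm assms(2,3) by (auto intro: monotone_on_subset)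
    fix t assume t: "max t0 (max (a p') (c q' + q')) \<le> t"
    show "(p' + int (cnt a p' t)) + (q' + int (cnt (\<lambda>n. c n + n) q' t)) = t + r"
      using cnt_raise[OF sm(1) assms(2), of t]
        cnt_raise[OF strict_mono_on_add_id[OF sm(2)] assms(3), of t] t0[of t] t by simp
  qed
qed

text \<open>A translation by \<open>(dx, dy)\<close> changes \<open>y - x\<close> by
  \<open>k\<close>, so labels above the diagonal rise by \<open>k\<close> and those below fall by
  \<open>k\<close>; this cancels in the sum of the thresholds. First coordinates grow by
  \<open>dx\<close>, which lowers the level by \<open>dx\<close>, and hence
  \<open>r\<close>.\<close>

lemma half_translate:
  assumes "half a c p q r" "k = dy - dx"
  shows "half (\<lambda>n. a (n - k) + dx) (\<lambda>n. c (n + k) + dy) (p + k) (q - k) (r - dx)"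
proof -
  from assms(1) obtain t0 where sm: "strict_mono_on {p..} a" "strict_mono_on {q..} c"
    and t0: "\<And>t. t \<ge> t0 \<Longrightarrow> (p + int (cnt a p t)) + (q + int (cnt (\<lambda>n. c n + n) q t)) = t + r"
    by (auto simp: half_def)
  show ?thesis unfolding half_def
  proof (intro conjI exI allI impI)
    show "strict_mono_on {p + k..} (\<lambda>n. a (n - k) + dx)"
      by (auto intro!: strict_mono_onI strict_mono_onD[OF sm(1)])
    show "strict_mono_on {q - k..} (\<lambda>n. c (n + k) + dy)"
      by (auto intro!: strict_mono_onI strict_mono_onD[OF sm(2)])
    fix t assume t: "t0 + dx \<le> t"
    have "(\<lambda>n. c (n + k) + dy + n) = (\<lambda>n. (c (n - (- k)) + (n - (- k))) + dx)"
      by (simp add: assms(2) fun_eq_iff del: minus_diff_eq)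
    then show "(p + k + int (cnt (\<lambda>n. a (n - k) + dx) (p + k) t)) +
        (q - k + int (cnt (\<lambda>n. c (n + k) + dy + n) (q - k) t)) = t + (r - dx)"
      using cnt_shift[of a k dx p t] cnt_shift[of "\<lambda>n. c n + n" "- k" dx q t] t0[of "t - dx"] t
      by simp
  qed
qed

lemma cnt_Suc:
  assumes "strict_mono_on {p..} f"
  shows "int (cnt f p (t + 1)) = int (cnt f p t) + of_bool (\<exists>n\<ge>p. f n = t + 1)"
proof -
  have fin: "finite {n. p \<le> n \<and> f n \<le> t}" for t
    by (rule finite_subset[of _ "{p..<p + int (cnt f p t)}"]) (use less_cnt_iff[OF assms] in auto)
  show ?thesis
  proof (cases "\<exists>n\<ge>p. f n = t + 1")
    case True
    then obtain n where n: "p \<le> n" "f n = t + 1" by blast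
    have uniq: "k = n" if k: "p \<le> k" "f k = t + 1" for k
    proof (rule ccontr)
      assume "k \<noteq> n"
      then consider "k < n" | "n < k" by linarith
      then show False
        using strict_mono_onD[OF assms, of k n] strict_mono_onD[OF assms, of n k] k n by cases auto
    qed
    have "{k. p \<le> k \<and> f k \<le> t + 1} = insert n {k. p \<le> k \<and> f k \<le> t}"
    proof (intro equalityI subsetI)
      fix k assume "k \<in> {k. p \<le> k \<and> f k \<le> t + 1}"
      then show "k \<in> insert n {k. p \<le> k \<and> f k \<le> t}"
        using uniq[of k] by (cases "f k = t + 1") simp_all
    qed (use n in auto)
    moreover have "n \<notin> {k. p \<le> k \<and> f k \<le> t}" using n by simp
    ultimately have "cnt f p (t + 1) = cnt f p t + 1"
      using card_insert_disjoint[OF fin] by (simp only: cnt_def Suc_eq_plus1)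
    then show ?thesis using True by simp
  next
    case False
    have "{k. p \<le> k \<and> f k \<le> t + 1} = {k. p \<le> k \<and> f k \<le> t}"
    proof (intro equalityI subsetI)
      fix k assume k: "k \<in> {k. p \<le> k \<and> f k \<le> t + 1}"
      then have "f k \<noteq> t + 1" using False by blast
      then show "k \<in> {k. p \<le> k \<and> f k \<le> t}" using k by simp
    qed auto
    then have "cnt f p (t + 1) = cnt f p t" by (simp only: cnt_def)
    then show ?thesis using False by simp
  qed
qed

text \<open>Beyond \<open>t0\<close> each integer is a value of exactly one of the two sequences, so
  the sum of the thresholds grows by one per level.\<close>

lemma half_of_partition:
  assumes sm: "strict_mono_on {p..} a" "strict_mono_on {q..} c"
    and part: "\<And>t. t > t0 \<Longrightarrow> (\<exists>n\<ge>p. a n = t) \<longleftrightarrow> \<not> (\<exists>n\<ge>q. c n + n = t)"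
  shows "\<exists>r. half a c p q r"
proof -
  let ?F = "\<lambda>t. (p + int (cnt a p t)) + (q + int (cnt (\<lambda>n. c n + n) q t))"
  have "?F t = t + (?F t0 - t0)" if "t \<ge> t0" for t
    using that
  proof (induction t rule: int_ge_induct)
    case (step i)
    have "?F (i + 1) = ?F i + 1"
      using part[of "i + 1"] step.hyps
      unfolding cnt_Suc[OF sm(1)] cnt_Suc[OF strict_mono_on_add_id[OF sm(2)]]
      by (cases "\<exists>n\<ge>p. a n = i + 1"; simp)
    with step.IH show ?case by simp
  qed simp
  with sm show ?thesis unfolding half_def by blast
qed

text \<open>The values \<open>c m + m\<close> grow by at least 2 per label, so they fill at most
  about half of the integers up to \<open>a n\<close>. The other half must come from
  \<open>a\<close>, whose threshold at level \<open>a n\<close> is \<open>n + 1\<close>.\<close>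

lemma half_bound:
  assumes "half a c p q r"
  shows "\<exists>B. \<forall>n\<ge>p. a n \<le> 2 * n + B"
proof -
  from assms obtain t0 where sm: "strict_mono_on {p..} a" "strict_mono_on {q..} c"
    and t0: "\<And>t. t \<ge> t0 \<Longrightarrow> (p + int (cnt a p t)) + (q + int (cnt (\<lambda>n. c n + n) q t)) = t + r"
    by (auto simp: half_def)
  define C where "C = \<bar>q - c q\<bar> + \<bar>2 * q\<bar> + 2"
  have C: "q - c q + 2 \<le> C" "2 * q \<le> C" by (simp_all add: C_def)
  have "a n \<le> 2 * n + max (max t0 0 - 2 * p) (C + 2 - 2 * r)"
    if n: "n \<ge> p" for n
  \<comment> \<open>From \<open>t0\<close> on the count identity is available; the bound
    \<open>0\<close> gives \<open>2 * q \<le> a n + C\<close> when no label from \<open>q\<close> on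
    has been counted.\<close>
  proof (cases "a n \<ge> max t0 0")
    case True
    have smb: "strict_mono_on {q..} (\<lambda>n. c n + n)" by (rule strict_mono_on_add_id[OF sm(2)])
    define m where "m = q + int (cnt (\<lambda>n. c n + n) q (a n))"
    have 1: "p + int (cnt a p (a n)) = n + 1"
      using less_cnt_iff[OF sm(1) n, of "a n"] less_cnt_iff[OF sm(1), of "n + 1" "a n"]
        strict_mono_on_int_diff[OF sm(1) n, of "n + 1"] n by simp
    have 2: "2 * m \<le> a n + C"
    proof (cases "m = q")
      case False
      then have mq: "m - 1 \<ge> q" by (simp add: m_def)
      moreover have "c (m - 1) + (m - 1) \<le> a n"
        using less_cnt_iff[OF smb mq, of "a n"] by (simp add: m_def)
      ultimately show ?thesis
        using strict_mono_on_int_diff[OF sm(2) order.refl, of "m - 1"] C(1) by simp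
    qed (use True C(2) in simp)
    have 3: "n + 1 + m = a n + r" using t0[of "a n"] True 1 by (simp add: m_def)
    have "a n \<le> 2 * n + (C + 2 - 2 * r)" using 2 3 by linarith
    then show ?thesis by simp
  next
    case False
    then have "a n \<le> 2 * n + (max t0 0 - 2 * p)" using n by linarith
    then show ?thesis by simp
  qed
  then show ?thesis by blast
qed

section \<open>Staircases and their translations\<close>

definition upper_pts :: "(int \<Rightarrow> int) \<Rightarrow> int \<Rightarrow> (int \<times> int) set" where
  "upper_pts a p = (\<lambda>n. (a n, a n + n)) ` {p..}"

definition lower_pts :: "(int \<Rightarrow> int) \<Rightarrow> int \<Rightarrow> (int \<times> int) set" where
  "lower_pts c q = (\<lambda>n. (c n + n, c n)) ` {q..}"

text \<open>The constant \<open>r\<close> belongs to the first coordinates \<open>a n\<close> and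
  \<open>c n + n\<close>, the constant \<open>s\<close> to the second coordinates \<open>c n\<close>
  and \<open>a n + n\<close>.\<close>

definition staircase :: "(int \<times> int) set \<Rightarrow> int \<Rightarrow> int \<Rightarrow> bool" where
  "staircase S r s \<longleftrightarrow> (\<exists>a c p q E. finite E \<and> S = E \<union> upper_pts a p \<union> lower_pts c q \<and>
     half a c p q r \<and> half c a q p s)"

lemma upper_pts_raise:
  "p \<le> p' \<Longrightarrow> upper_pts a p = (\<lambda>n. (a n, a n + n)) ` {p..<p'} \<union> upper_pts a p'"
  unfolding upper_pts_def image_Un[symmetric] by (simp add: ivl_disj_un)

lemma lower_pts_raise:
  "p \<le> p' \<Longrightarrow> lower_pts a p = (\<lambda>n. (a n + n, a n)) ` {p..<p'} \<union> lower_pts a p'"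
  unfolding lower_pts_def image_Un[symmetric] by (simp add: ivl_disj_un)

text \<open>Comparing two staircases label by label needs one common starting label. Raising it
  moves finitely many points into \<open>E\<close> and keeps \<open>r\<close> and \<open>s\<close>
  by \<open>half_raise\<close>.\<close>

lemma staircase_from:
  assumes "staircase S r s"
  shows "\<exists>p0. \<forall>p\<ge>p0. \<exists>a c E. finite E \<and> S = E \<union> upper_pts a p \<union> lower_pts c p \<and>
     half a c p p r \<and> half c a p p s"
proof -
  obtain a c p q E where *: "finite E" "S = E \<union> upper_pts a p \<union> lower_pts c q"
     "half a c p q r" "half c a q p s" using assms by (auto simp: staircase_def)
  show ?thesis
  proof (intro exI allI impI conjI)
    fix k assume k: "max p q \<le> k"
    show "half a c k k r" "half c a k k s" using * k by (auto intro: half_raise)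
    let ?E = "E \<union> (\<lambda>n. (a n, a n + n)) ` {p..<k} \<union> (\<lambda>n. (c n + n, c n)) ` {q..<k}"
    show "finite ?E" using * by simp
    show "S = ?E \<union> upper_pts a k \<union> lower_pts c k"
      unfolding *(2) using upper_pts_raise[of p k a] lower_pts_raise[of q k c] k by auto
  qed
qed

lemma translate_conv_image: "translate S d = (\<lambda>(x, y). (x + fst d, y + snd d)) ` S"
  by (auto simp: translate_def image_iff)

lemma upper_pts_translate:
  assumes "k = dy - dx"
  shows "translate (upper_pts a p) (dx, dy) = upper_pts (\<lambda>n. a (n - k) + dx) (p + k)"
proof -
  have "{p + k..} = (\<lambda>n. n + k) ` {p..}" by (auto intro: image_eqI[of _ _ "_ - k"])
  then show ?thesis
    by (simp add: translate_conv_image upper_pts_def image_image assms algebra_simps)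
qed

lemma lower_pts_translate:
  assumes "k = dy - dx"
  shows "translate (lower_pts c q) (dx, dy) = lower_pts (\<lambda>n. c (n + k) + dy) (q - k)"
proof -
  have "{q - k..} = (\<lambda>n. n - k) ` {q..}" by (auto intro: image_eqI[of _ _ "_ + k"])
  then show ?thesis
    by (simp add: translate_conv_image lower_pts_def image_image assms algebra_simps)
qed

lemma staircase_translate:
  assumes "staircase S r s"
  shows "staircase (translate S (dx, dy)) (r - dx) (s - dy)"
proof -
  obtain a c p q E where *: "finite E" "S = E \<union> upper_pts a p \<union> lower_pts c q"
     "half a c p q r" "half c a q p s" using assms by (auto simp: staircase_def)
  define k where "k = dy - dx"
  have k': "- k = dx - dy" by (simp add: k_def)
  show ?thesis unfolding staircase_def
  proof (intro exI conjI)
    show "half (\<lambda>n. a (n - k) + dx) (\<lambda>n. c (n + k) + dy) (p + k) (q - k) (r - dx)"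
      using *(3) k_def by (rule half_translate)
    \<comment> \<open>Exchanging \<open>a\<close> and \<open>c\<close> exchanges the coordinates, so
      \<open>dx\<close> and \<open>dy\<close> swap and \<open>k\<close> changes sign.\<close>
    show "half (\<lambda>n. c (n + k) + dy) (\<lambda>n. a (n - k) + dx) (q - k) (p + k) (s - dy)"
      using half_translate[OF *(4) k'] by simp
    show "finite (translate E (dx, dy))" using * by (simp add: translate_conv_image)
    show "translate S (dx, dy) = translate E (dx, dy) \<union> upper_pts (\<lambda>n. a (n - k) + dx) (p + k)
       \<union> lower_pts (\<lambda>n. c (n + k) + dy) (q - k)"
      unfolding upper_pts_translate[OF k_def, symmetric] lower_pts_translate[OF k_def, symmetric]
      unfolding *(2) translate_conv_image image_Un ..
  qed
qed

subsection \<open>Contraction of the mismatch\<close>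

text \<open>Summing the distance of the two counting functions up to level \<open>N\<close> counts the pairs below.
  Read by rows of fixed \<open>n\<close> it is the distance of the two sequences. Complementary sequences have
  the same distance of counting functions, and \<open>n\<close> cancels between \<open>c n + n\<close> and \<open>C n + n\<close>; this
  compares level \<open>N\<close> with level about \<open>2 N / 3\<close>.\<close>

definition mism :: "(int \<Rightarrow> int) \<Rightarrow> (int \<Rightarrow> int) \<Rightarrow> int \<Rightarrow> int \<Rightarrow> (int \<times> int) set" where
  "mism f g p N = {(t, n). t \<le> N \<and> p \<le> n \<and> (f n \<le> t) \<noteq> (g n \<le> t)}"

lemma finite_mism:
  assumes "strict_mono_on {p..} f" "strict_mono_on {p..} g"
  shows "finite (mism f g p N)"
proof (rule finite_subset)
  let ?m = "min (f p) (g p)"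
  show "mism f g p N \<subseteq> {?m..N} \<times> {p..p + (N - ?m)}"
  proof
    fix z assume "z \<in> mism f g p N"
    then obtain t n where z: "z = (t, n)" "t \<le> N" "p \<le> n" and "(f n \<le> t) \<noteq> (g n \<le> t)"
      by (auto simp: mism_def)
    then have "f n \<le> t \<or> g n \<le> t" by auto
    then have "?m \<le> t" "n \<le> p + (N - ?m)"
      using z strict_mono_on_int_diff[OF assms(1) order.refl, of n]
        strict_mono_on_int_diff[OF assms(2) order.refl, of n] by linarith+
    then show "z \<in> {?m..N} \<times> {p..p + (N - ?m)}" using z by auto
  qed
qed simp

text \<open>At a fixed level the mismatching labels are exactly those between the two
  thresholds.\<close>

lemma mism_slice:
  assumes "strict_mono_on {p..} f" "strict_mono_on {p..} g"
  shows "finite {n. p \<le> n \<and> (f n \<le> t) \<noteq> (g n \<le> t)}"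
    and "int (card {n. p \<le> n \<and> (f n \<le> t) \<noteq> (g n \<le> t)}) = \<bar>int (cnt f p t) - int (cnt g p t)\<bar>"
proof -
  let ?a = "p + int (cnt f p t)" and ?b = "p + int (cnt g p t)"
  have *: "{n. p \<le> n \<and> (f n \<le> t) \<noteq> (g n \<le> t)} = {min ?a ?b..<max ?a ?b}"
    by (auto simp: less_cnt_iff[OF assms(1)] less_cnt_iff[OF assms(2)] min_def max_def not_less
        split: if_splits)
  show "finite {n. p \<le> n \<and> (f n \<le> t) \<noteq> (g n \<le> t)}" unfolding * by simp
  show "int (card {n. p \<le> n \<and> (f n \<le> t) \<noteq> (g n \<le> t)}) = \<bar>int (cnt f p t) - int (cnt g p t)\<bar>"
    unfolding * by (auto simp: min_def max_def abs_if)
qed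

text \<open>Here the equality of the constants \<open>r\<close> enters: subtracting the two count
  identities shows that from \<open>t0\<close> on the slices of both mismatch sets have the same
  size. The levels up to \<open>t0\<close> go into \<open>K\<close>.\<close>

lemma mism_compl:
  assumes h1: "half a c p p r" and h2: "half A C p p r"
  shows "\<exists>K. \<forall>N. card (mism a A p N) \<le> K + card (mism (\<lambda>n. c n + n) (\<lambda>n. C n + n) p N)"
proof -
  let ?c = "\<lambda>n. c n + n" and ?C = "\<lambda>n. C n + n"
  from h1 obtain t1 where sm1: "strict_mono_on {p..} a" "strict_mono_on {p..} c"
    and t1: "\<And>t. t \<ge> t1 \<Longrightarrow> (p + int (cnt a p t)) + (p + int (cnt ?c p t)) = t + r"
    by (auto simp: half_def)
  from h2 obtain t2 where sm2: "strict_mono_on {p..} A" "strict_mono_on {p..} C"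
    and t2: "\<And>t. t \<ge> t2 \<Longrightarrow> (p + int (cnt A p t)) + (p + int (cnt ?C p t)) = t + r"
    by (auto simp: half_def)
  define t0 where "t0 = max t1 t2"
  note smc = strict_mono_on_add_id[OF sm1(2)] strict_mono_on_add_id[OF sm2(2)]
  let ?s = "\<lambda>t. {n. p \<le> n \<and> (a n \<le> t) \<noteq> (A n \<le> t)}"
    and ?S = "\<lambda>t. {n. p \<le> n \<and> (?c n \<le> t) \<noteq> (?C n \<le> t)}"
  have card_eq: "card (?s t) = card (?S t)" if "t \<ge> t0" for t
    using t1[of t] t2[of t] that mism_slice(2)[OF sm1(1) sm2(1), of t] mism_slice(2)[OF smc, of t]
    by (simp add: t0_def)
  have "card (mism a A p N) \<le> card (mism a A p t0) + card (mism ?c ?C p N)" for N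
  proof -
    have "mism a A p N \<subseteq> mism a A p t0 \<union> Sigma {t0<..N} ?s"
      by (auto simp: mism_def)
    moreover have "finite (Sigma {t0<..N} ?s)"
      by (intro finite_SigmaI mism_slice(1)[OF sm1(1) sm2(1)]) simp
    ultimately have "card (mism a A p N) \<le> card (mism a A p t0 \<union> Sigma {t0<..N} ?s)"
      by (intro card_mono finite_UnI finite_mism sm1 sm2)
    also have "\<dots> \<le> card (mism a A p t0) + card (Sigma {t0<..N} ?s)"
      by (rule card_Un_le)
    also have "card (Sigma {t0<..N} ?s) = (\<Sum>t\<in>{t0<..N}. card (?s t))"
      by (intro card_SigmaI ballI mism_slice(1)[OF sm1(1) sm2(1)]) simp
    also have "\<dots> = (\<Sum>t\<in>{t0<..N}. card (?S t))"
      by (rule sum.cong[OF refl], rule card_eq) simp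
    also have "\<dots> = card (Sigma {t0<..N} ?S)"
      by (intro card_SigmaI[symmetric] ballI mism_slice(1)[OF smc]) simp
    also have "\<dots> \<le> card (mism ?c ?C p N)"
      by (intro card_mono finite_mism[OF smc]) (auto simp: mism_def)
    finally show ?thesis by simp
  qed
  then show ?thesis by blast
qed

text \<open>Lowering the level by \<open>n\<close> removes the common summand \<open>n\<close>. A
  mismatch at level \<open>t\<close> means that one sequence still exceeds \<open>t\<close>, so
  \<open>t < 3 * n + B\<close> by \<open>half_bound\<close>, and the new level \<open>t - n\<close>
  is at most about two thirds of \<open>N\<close>.\<close>

lemma mism_contract:
  assumes "half c a p q r" "half C A p q' r'"
  shows "\<exists>B\<ge>0. \<forall>N. card (mism (\<lambda>n. c n + n) (\<lambda>n. C n + n) p N) \<le> card (mism c C p ((2 * N + B) div 3))"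
proof -
  from half_bound[OF assms(1)] half_bound[OF assms(2)] obtain B1 B2 where
    B: "\<And>n. n \<ge> p \<Longrightarrow> c n \<le> 2 * n + B1" "\<And>n. n \<ge> p \<Longrightarrow> C n \<le> 2 * n + B2" by blast
  define B where "B = max 0 (max B1 B2)"
  have sm: "strict_mono_on {p..} c" "strict_mono_on {p..} C"
    using assms by (auto simp: half_def)
  have "card (mism (\<lambda>n. c n + n) (\<lambda>n. C n + n) p N) \<le> card (mism c C p ((2 * N + B) div 3))" for N
  proof (rule card_inj_on_le[where f = "\<lambda>(t, n). (t - n, n)"])
    show "inj_on (\<lambda>(t, n). (t - n, n)) (mism (\<lambda>n. c n + n) (\<lambda>n. C n + n) p N)"
      by (auto simp: inj_on_def)
    show "finite (mism c C p ((2 * N + B) div 3))" by (rule finite_mism[OF sm])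
    show "(\<lambda>(t, n). (t - n, n)) ` mism (\<lambda>n. c n + n) (\<lambda>n. C n + n) p N \<subseteq> mism c C p ((2 * N + B) div 3)"
    proof clarify
      fix t n assume "(t, n) \<in> mism (\<lambda>n. c n + n) (\<lambda>n. C n + n) p N"
      then have *: "t \<le> N" "p \<le> n" "(c n + n \<le> t) \<noteq> (C n + n \<le> t)" by (simp_all add: mism_def)
      then have "t < c n + n \<or> t < C n + n" by auto
      moreover have "c n \<le> 2 * n + B" "C n \<le> 2 * n + B"
        using B[OF *(2)] by (simp_all add: B_def)
      ultimately have "t < 3 * n + B" by (elim disjE; linarith)
      then have "3 * t - 3 * n \<le> 2 * N + B" using *(1) by linarith
      then have "t - n \<le> (2 * N + B) div 3" by linarith
      then show "(t - n, n) \<in> mism c C p ((2 * N + B) div 3)"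
        using *(2,3) by (simp add: mism_def le_diff_eq)
    qed
  qed
  moreover have "0 \<le> B" by (simp add: B_def)
  ultimately show ?thesis by blast
qed

text \<open>Each contraction costs only the constant \<open>K\<close>, while the allowance
  \<open>\<epsilon> * n\<close> shrinks by about a third; for large \<open>n\<close> this pays for
  \<open>K\<close>.\<close>

lemma sublinear_from_contraction:
  fixes G :: "int \<Rightarrow> real"
  assumes mono: "\<And>m n. m \<le> n \<Longrightarrow> G m \<le> G n" and K: "K \<ge> 0" and B: "B \<ge> 0"
    and contr: "\<And>n. n \<ge> 0 \<Longrightarrow> G n \<le> K + G ((2 * n + B) div 3)" and "\<epsilon> > 0"
  shows "\<exists>D\<ge>0. \<forall>n\<ge>0. G n \<le> \<epsilon> * of_int n + D"
proof -
  obtain M0 :: nat where M0: "(\<epsilon> * of_int B + 3 * K) / \<epsilon> \<le> real M0"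
    using real_arch_simple by blast
  \<comment> \<open>Beyond \<open>M0\<close> the gain \<open>\<epsilon> * (n - B) / 3\<close> covers
    \<open>K\<close>; the entry \<open>B + 1\<close> makes the contracted argument smaller than
    \<open>n\<close>, as the induction needs.\<close>
  define M where "M = max (int M0) (B + 1)"
  have "(\<epsilon> * of_int B + 3 * K) / \<epsilon> \<le> of_int M" using M0 by (simp add: M_def)
  then have M: "\<epsilon> * of_int B + 3 * K \<le> \<epsilon> * of_int M"
    using \<open>\<epsilon> > 0\<close> by (simp add: pos_divide_le_eq mult.commute)
  define D where "D = \<bar>G M\<bar>"
  have *: "G (int n) \<le> \<epsilon> * real n + D" for n
  proof (induction n rule: less_induct)
    case (less n)
    show ?case
    proof (cases "int n \<le> M")
      case True
      then have "G (int n) \<le> D" using mono[OF True] by (simp add: D_def)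
      moreover have "0 \<le> \<epsilon> * real n" using \<open>\<epsilon> > 0\<close> by simp
      ultimately show ?thesis by simp
    next
      case False
      define m where "m = (2 * int n + B) div 3"
      have m: "0 \<le> m" "m < int n" "3 * m \<le> 2 * int n + B"
        using False B by (auto simp: m_def M_def)
      have "3 * of_int m \<le> 2 * real n + of_int B"
        using m(3) by linarith
      then have "\<epsilon> * (3 * of_int m) \<le> \<epsilon> * (2 * real n + of_int B)"
        using \<open>\<epsilon> > 0\<close> by (intro mult_left_mono) auto
      moreover have "\<epsilon> * of_int M \<le> \<epsilon> * real n"
        using \<open>\<epsilon> > 0\<close> False by (intro mult_left_mono) auto
      moreover have "G m \<le> \<epsilon> * of_int m + D" using less.IH[of "nat m"] m by simp
      moreover have "G (int n) \<le> K + G m" using contr[of "int n"] by (simp add: m_def)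
      ultimately show ?thesis using M by (simp add: algebra_simps)
    qed
  qed
  show ?thesis
  proof (intro exI conjI allI impI)
    show "D \<ge> 0" by (simp add: D_def)
    fix n :: int assume "n \<ge> 0"
    then show "G n \<le> \<epsilon> * of_int n + D" using *[of "nat n"] by simp
  qed
qed

subsection \<open>Asymptotic equality of staircases\<close>

lemma lattice_discD:
  assumes "(x, y) \<in> lattice_disc n"
  shows "\<bar>x\<bar> \<le> int n" "\<bar>y\<bar> \<le> int n"
proof -
  have "x\<^sup>2 + y\<^sup>2 \<le> (int n)\<^sup>2" using assms by (simp add: lattice_disc_def)
  then have "x\<^sup>2 \<le> (int n)\<^sup>2" "y\<^sup>2 \<le> (int n)\<^sup>2"
    using zero_le_power2[of x] zero_le_power2[of y] by linarith+
  then show "\<bar>x\<bar> \<le> int n" "\<bar>y\<bar> \<le> int n"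
    by (simp_all flip: abs_le_square_iff)
qed

lemma finite_lattice_disc: "finite (lattice_disc n)"
proof (rule finite_subset)
  show "lattice_disc n \<subseteq> {- int n..int n} \<times> {- int n..int n}"
  proof
    fix z assume "z \<in> lattice_disc n"
    then show "z \<in> {- int n..int n} \<times> {- int n..int n}"
      using lattice_discD[of "fst z" "snd z" n] by (cases z) (auto simp: abs_le_iff)
  qed
qed simp

lemma lattice_discI:
  assumes "\<bar>x\<bar> + \<bar>y\<bar> \<le> int n"
  shows "(x, y) \<in> lattice_disc n"
proof -
  have "x\<^sup>2 + y\<^sup>2 \<le> (\<bar>x\<bar> + \<bar>y\<bar>)\<^sup>2" by (simp add: power2_sum)
  also have "\<dots> \<le> (int n)\<^sup>2" using assms by (intro power_mono) auto
  finally show ?thesis by (simp add: lattice_disc_def)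
qed

text \<open>If \<open>f n \<noteq> g n\<close>, then at level \<open>min (f n) (g n)\<close> only
  one of the two has been reached, so each such label yields its own pair in
  \<open>mism\<close>.\<close>

lemma mism_le:
  assumes sm: "strict_mono_on {p..} f" "strict_mono_on {p..} g"
  shows "finite {n. p \<le> n \<and> f n \<le> N \<and> f n \<noteq> g n}"
    "card {n. p \<le> n \<and> f n \<le> N \<and> f n \<noteq> g n} \<le> card (mism f g p N)"
proof -
  let ?h = "\<lambda>n. (min (f n) (g n), n)"
  have "?h ` {n. p \<le> n \<and> f n \<le> N \<and> f n \<noteq> g n} \<subseteq> mism f g p N"
    by (auto simp: mism_def min_le_iff_disj)
  moreover have "inj_on ?h {n. p \<le> n \<and> f n \<le> N \<and> f n \<noteq> g n}"
    by (auto simp: inj_on_def)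
  moreover have "finite (mism f g p N)" by (rule finite_mism[OF sm])
  ultimately show "finite {n. p \<le> n \<and> f n \<le> N \<and> f n \<noteq> g n}"
    "card {n. p \<le> n \<and> f n \<le> N \<and> f n \<noteq> g n} \<le> card (mism f g p N)"
    by (auto intro: card_inj_on_le inj_on_finite)
qed

text \<open>The mismatch of \<open>a\<close> is bounded by that of \<open>c\<close> at a contracted
  level and conversely, so the sum of both satisfies the contraction inequality.\<close>

lemma mism_sublinear:
  assumes "half a c p p r" "half c a p p s" "half A C p p r" "half C A p p s" "\<epsilon> > 0"
  shows "\<exists>D\<ge>0. \<forall>n::nat. real (card (mism a A p (int n)) + card (mism c C p (int n))) \<le> \<epsilon> * real n + D"
proof -
  let ?G = "\<lambda>n. real (card (mism a A p n) + card (mism c C p n))"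
  from mism_compl[OF assms(1,3)] obtain K1 where K1:
    "\<And>N. card (mism a A p N) \<le> K1 + card (mism (\<lambda>n. c n + n) (\<lambda>n. C n + n) p N)" by blast
  from mism_compl[OF assms(2,4)] obtain K2 where K2:
    "\<And>N. card (mism c C p N) \<le> K2 + card (mism (\<lambda>n. a n + n) (\<lambda>n. A n + n) p N)" by blast
  from mism_contract[OF assms(2,4)] obtain B1 where B1: "B1 \<ge> 0"
    "\<And>N. card (mism (\<lambda>n. c n + n) (\<lambda>n. C n + n) p N) \<le> card (mism c C p ((2 * N + B1) div 3))" by blast
  from mism_contract[OF assms(1,3)] obtain B2 where B2: "B2 \<ge> 0"
    "\<And>N. card (mism (\<lambda>n. a n + n) (\<lambda>n. A n + n) p N) \<le> card (mism a A p ((2 * N + B2) div 3))" by blast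
  have sm: "strict_mono_on {p..} a" "strict_mono_on {p..} A" "strict_mono_on {p..} c" "strict_mono_on {p..} C"
    using assms by (auto simp: half_def)
  have mono: "card (mism a A p m) \<le> card (mism a A p n)" "card (mism c C p m) \<le> card (mism c C p n)"
    if "m \<le> n" for m n
    by (intro card_mono finite_mism sm; use that in \<open>auto simp: mism_def\<close>)+
  define B where "B = max B1 B2"
  have "\<exists>D\<ge>0. \<forall>n\<ge>0. ?G n \<le> \<epsilon> * of_int n + D"
  proof (rule sublinear_from_contraction[where K = "real (K1 + K2)" and B = B])
    show "?G m \<le> ?G n" if "m \<le> n" for m n
      using mono[OF that] by linarith
    show "?G n \<le> real (K1 + K2) + ?G ((2 * n + B) div 3)" for n
    proof -
      have "(2 * n + B1) div 3 \<le> (2 * n + B) div 3" "(2 * n + B2) div 3 \<le> (2 * n + B) div 3"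
        by (auto simp: B_def intro: zdiv_mono1)
      from mono(2)[OF this(1)] mono(1)[OF this(2)]
      have "card (mism a A p n) + card (mism c C p n) \<le>
          (K1 + K2) + (card (mism a A p ((2 * n + B) div 3)) + card (mism c C p ((2 * n + B) div 3)))"
        using K1[of n] K2[of n] B1(2)[of n] B2(2)[of n] by linarith
      then show ?thesis by (simp only: of_nat_add[symmetric] of_nat_le_iff)
    qed
  qed (use B1(1) assms(5) in \<open>simp_all add: B_def\<close>)
  then obtain D where "D \<ge> 0" "\<And>n. n \<ge> 0 \<Longrightarrow> ?G n \<le> \<epsilon> * of_int n + D" by blast
  from this(1) this(2)[of "int _"] show ?thesis by (intro exI[of _ D]) auto
qed

text \<open>By \<open>half_bound\<close> the coordinates of the point with label \<open>k\<close>
  add up to at most \<open>5 * k + 2 * B\<close>, so all labels up to about \<open>n / 5\<close>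
  stay in the disc.\<close>

lemma upper_pts_disc_lower_bound:
  assumes "half a c p q r"
  shows "\<exists>D\<ge>0. \<forall>n. real n / 5 - D \<le> real (card (upper_pts a p \<inter> lattice_disc n))"
proof -
  from half_bound[OF assms] obtain B where B: "\<And>n. n \<ge> p \<Longrightarrow> a n \<le> 2 * n + B" by blast
  have sm: "strict_mono_on {p..} a" using assms by (simp add: half_def)
  \<comment> \<open>From \<open>p'\<close> on both the label and \<open>a k\<close> are
    non-negative, the latter because \<open>a k \<ge> a p + (k - p)\<close>.\<close>
  define p' where "p' = max p (max 0 (p - a p))"
  define D where "D = \<bar>p'\<bar> + 2 * \<bar>B\<bar> + 1"
  have "real n / 5 - of_int D \<le> real (card (upper_pts a p \<inter> lattice_disc n))" for n
  proof -
    define h where "h = (int n - 2 * \<bar>B\<bar>) div 5"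
    have div5: "5 * (x div 5) \<le> x" "x - 4 \<le> 5 * (x div 5)" for x :: int by presburger+
    have h: "5 * h \<le> int n - 2 * \<bar>B\<bar>" "int n - 2 * \<bar>B\<bar> - 4 \<le> 5 * h"
      unfolding h_def by (rule div5)+
    let ?I = "{p'..h}"
    have "(\<lambda>k. (a k, a k + k)) ` ?I \<subseteq> upper_pts a p \<inter> lattice_disc n"
    proof (clarify, rule IntI)
      fix k assume k: "k \<in> ?I"
      then have kp: "p \<le> k" "0 \<le> k" by (auto simp: p'_def)
      then show "(a k, a k + k) \<in> upper_pts a p" by (auto simp: upper_pts_def)
      have "0 \<le> a k"
        using strict_mono_on_int_diff[OF sm order.refl kp(1)] k by (simp add: p'_def)
      moreover have "a k \<le> 2 * k + B" using B kp by simp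
      moreover have "5 * k \<le> int n - 2 * \<bar>B\<bar>" using k h(1) by auto
      ultimately have "\<bar>a k\<bar> + \<bar>a k + k\<bar> \<le> int n" using kp by linarith
      then show "(a k, a k + k) \<in> lattice_disc n" by (rule lattice_discI)
    qed
    then have "card ((\<lambda>k. (a k, a k + k)) ` ?I) \<le> card (upper_pts a p \<inter> lattice_disc n)"
      by (intro card_mono) (auto simp: finite_lattice_disc)
    moreover have "card ((\<lambda>k. (a k, a k + k)) ` ?I) = card ?I"
      by (rule card_image) (auto simp: inj_on_def)
    moreover have "h + 1 - p' \<le> int (card ?I)" by simp
    ultimately have "h + 1 - p' \<le> int (card (upper_pts a p \<inter> lattice_disc n))"
      by linarith
    then have "int n - 5 * D \<le> 5 * int (card (upper_pts a p \<inter> lattice_disc n))"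
      using h(2) abs_ge_self[of p'] abs_ge_zero[of B] unfolding D_def by (simp add: algebra_simps)
    then have "real_of_int (int n - 5 * D) \<le> real_of_int (5 * int (card (upper_pts a p \<inter> lattice_disc n)))"
      by (simp only: of_int_le_iff)
    then show ?thesis by simp
  qed
  then show ?thesis by (intro exI[of _ "of_int D"]) (auto simp: D_def)
qed

lemma upper_pts_disc_upper_bound:
  assumes sm: "strict_mono_on {p..} a"
  shows "\<exists>D\<ge>0. \<forall>n. real (card (upper_pts a p \<inter> lattice_disc n)) \<le> real n + D"
proof -
  define D where "D = \<bar>a p\<bar> + 1"
  have "real (card (upper_pts a p \<inter> lattice_disc n)) \<le> real n + of_int D" for n
  proof -
    have "upper_pts a p \<inter> lattice_disc n \<subseteq> (\<lambda>k. (a k, a k + k)) ` {p..p + (int n - a p)}"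
    proof
      fix z assume z: "z \<in> upper_pts a p \<inter> lattice_disc n"
      then obtain k where k: "p \<le> k" "z = (a k, a k + k)" by (auto simp: upper_pts_def)
      then have "a k \<le> int n" using lattice_discD(1)[of "a k" "a k + k" n] z by auto
      then show "z \<in> (\<lambda>k. (a k, a k + k)) ` {p..p + (int n - a p)}"
        using strict_mono_on_int_diff[OF sm order.refl k(1)] k by auto
    qed
    then have "card (upper_pts a p \<inter> lattice_disc n) \<le> card {p..p + (int n - a p)}"
      by (rule surj_card_le[rotated]) simp
    then have "int (card (upper_pts a p \<inter> lattice_disc n)) \<le> int n + D" by (simp add: D_def)
    then show ?thesis by linarith
  qed
  then show ?thesis by (intro exI[of _ "of_int D"]) (auto simp: D_def)
qed

lemma lower_pts_swap: "lower_pts c q = prod.swap ` upper_pts c q"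
  by (simp add: lower_pts_def upper_pts_def image_image)

lemma lower_pts_disc_card:
  "card (lower_pts c q \<inter> lattice_disc n) = card (upper_pts c q \<inter> lattice_disc n)"
proof -
  have "lower_pts c q \<inter> lattice_disc n = prod.swap ` (upper_pts c q \<inter> lattice_disc n)"
    by (auto simp: lower_pts_swap lattice_disc_def add.commute)
  then show ?thesis by (simp add: card_image)
qed

text \<open>The label of a point is the difference of its coordinates, so a point can be missing
  from the other set only if the two sequences differ at that label.\<close>

lemma upper_pts_diff:
  assumes sm: "strict_mono_on {p..} a" "strict_mono_on {p..} A"
  shows "card ((upper_pts a p - upper_pts A p) \<inter> lattice_disc n) \<le> card (mism a A p (int n))"
proof -
  let ?I = "{k. p \<le> k \<and> a k \<le> int n \<and> a k \<noteq> A k}"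
  have "(upper_pts a p - upper_pts A p) \<inter> lattice_disc n \<subseteq> (\<lambda>k. (a k, a k + k)) ` ?I"
  proof
    fix z assume z: "z \<in> (upper_pts a p - upper_pts A p) \<inter> lattice_disc n"
    then obtain k where k: "p \<le> k" "z = (a k, a k + k)" by (auto simp: upper_pts_def)
    then have "a k \<le> int n" using lattice_discD(1)[of "a k" "a k + k" n] z by auto
    moreover have "a k \<noteq> A k" using z k by (auto simp: upper_pts_def)
    ultimately show "z \<in> (\<lambda>k. (a k, a k + k)) ` ?I" using k by auto
  qed
  then have "card ((upper_pts a p - upper_pts A p) \<inter> lattice_disc n) \<le> card ?I"
    by (rule surj_card_le[rotated]) (rule mism_le(1)[OF sm])
  with mism_le(2)[OF sm, of "int n"] show ?thesis by linarith
qed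

lemma lower_pts_diff:
  assumes sm: "strict_mono_on {p..} a" "strict_mono_on {p..} A"
  shows "card ((lower_pts a p - lower_pts A p) \<inter> lattice_disc n) \<le> card (mism a A p (int n))"
proof -
  have "(lower_pts a p - lower_pts A p) \<inter> lattice_disc n =
      prod.swap ` ((upper_pts a p - upper_pts A p) \<inter> lattice_disc n)"
    by (auto simp: lower_pts_swap lattice_disc_def add.commute)
  then show ?thesis using upper_pts_diff[OF sm] by (simp add: card_image)
qed

lemma infinite_upper_pts: "infinite (upper_pts a p)"
proof -
  have "inj_on (\<lambda>n. (a n, a n + n)) {p..}" by (auto simp: inj_on_def)
  then show ?thesis by (simp add: upper_pts_def finite_image_iff infinite_Ici)
qed

lemma staircase_diff_sublinear:
  assumes "staircase S r s" "staircase T r s" "\<epsilon> > 0"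
  shows "\<exists>D\<ge>0. \<forall>n. real (card ((S - T) \<inter> lattice_disc n)) \<le> \<epsilon> * real n + D"
proof -
  from staircase_from[OF assms(1)] staircase_from[OF assms(2)] obtain p1 p2 where
    "\<And>p. p \<ge> p1 \<Longrightarrow> \<exists>a c E. finite E \<and> S = E \<union> upper_pts a p \<union> lower_pts c p \<and>
     half a c p p r \<and> half c a p p s"
    "\<And>p. p \<ge> p2 \<Longrightarrow> \<exists>a c E. finite E \<and> T = E \<union> upper_pts a p \<union> lower_pts c p \<and>
     half a c p p r \<and> half c a p p s" by blast
  from this(1)[of "max p1 p2"] this(2)[of "max p1 p2"] obtain p a c E A C F where
    S: "finite E" "S = E \<union> upper_pts a p \<union> lower_pts c p" "half a c p p r" "half c a p p s" and
    T: "finite F" "T = F \<union> upper_pts A p \<union> lower_pts C p" "half A C p p r" "half C A p p s"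
    by (metis max.cobounded1 max.cobounded2)
  have sm: "strict_mono_on {p..} a" "strict_mono_on {p..} A" "strict_mono_on {p..} c" "strict_mono_on {p..} C"
    using S T by (auto simp: half_def)
  from mism_sublinear[OF S(3,4) T(3,4) assms(3)] obtain D where D: "D \<ge> 0"
    "\<And>n. real (card (mism a A p (int n)) + card (mism c C p (int n))) \<le> \<epsilon> * real n + D" by blast
  have "real (card ((S - T) \<inter> lattice_disc n)) \<le> \<epsilon> * real n + (D + card E)" for n
  proof -
    let ?L = "lattice_disc n"
    have "(S - T) \<inter> ?L \<subseteq> E \<union> ((upper_pts a p - upper_pts A p) \<inter> ?L) \<union> ((lower_pts c p - lower_pts C p) \<inter> ?L)"
      unfolding S(2) T(2) by auto
    then have "card ((S - T) \<inter> ?L) \<le> card (E \<union> ((upper_pts a p - upper_pts A p) \<inter> ?L) \<union> ((lower_pts c p - lower_pts C p) \<inter> ?L))"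
      by (rule card_mono[rotated]) (simp add: S(1) finite_lattice_disc)
    also have "\<dots> \<le> card (E \<union> ((upper_pts a p - upper_pts A p) \<inter> ?L)) + card ((lower_pts c p - lower_pts C p) \<inter> ?L)"
      by (rule card_Un_le)
    also have "\<dots> \<le> card E + card ((upper_pts a p - upper_pts A p) \<inter> ?L) + card ((lower_pts c p - lower_pts C p) \<inter> ?L)"
      by (rule add_right_mono card_Un_le)+
    also have "\<dots> \<le> card E + card (mism a A p (int n)) + card (mism c C p (int n))"
      by (intro add_mono order.refl upper_pts_diff lower_pts_diff sm)
    finally show ?thesis using D(2)[of n] by linarith
  qed
  then show ?thesis using D(1) by (intro exI[of _ "D + card E"]) auto
qed

lemma staircase_disc_bounds:
  assumes "staircase S r s"
  shows "infinite S"
    and "\<exists>D\<ge>0. \<forall>n. real n / 5 - D \<le> real (card (S \<inter> lattice_disc n))"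
    and "\<exists>D\<ge>0. \<forall>n. real (card (S \<inter> lattice_disc n)) \<le> 2 * real n + D"
proof -
  obtain a c p q E where S: "finite E" "S = E \<union> upper_pts a p \<union> lower_pts c q"
     "half a c p q r" "half c a q p s" using assms by (auto simp: staircase_def)
  then show "infinite S" using infinite_upper_pts[of a p] by auto
  have sub: "card (upper_pts a p \<inter> lattice_disc n) \<le> card (S \<inter> lattice_disc n)" for n
    by (rule card_mono) (auto simp: S(2) finite_lattice_disc)
  from upper_pts_disc_lower_bound[OF S(3)] obtain D where D: "D \<ge> 0"
    "\<And>n. real n / 5 - D \<le> real (card (upper_pts a p \<inter> lattice_disc n))" by blast
  have "real n / 5 - D \<le> real (card (S \<inter> lattice_disc n))" for n
    using D(2)[of n] sub[of n] by linarith
  with D(1) show "\<exists>D\<ge>0. \<forall>n. real n / 5 - D \<le> real (card (S \<inter> lattice_disc n))" by blast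
  have sm: "strict_mono_on {p..} a" "strict_mono_on {q..} c"
    using S by (auto simp: half_def)
  from upper_pts_disc_upper_bound[OF sm(1)] upper_pts_disc_upper_bound[OF sm(2)]
  obtain D1 D2 where D: "D1 \<ge> 0" "\<And>n. real (card (upper_pts a p \<inter> lattice_disc n)) \<le> real n + D1"
    "D2 \<ge> 0" "\<And>n. real (card (upper_pts c q \<inter> lattice_disc n)) \<le> real n + D2" by blast
  have "real (card (S \<inter> lattice_disc n)) \<le> 2 * real n + (card E + D1 + D2)" for n
  proof -
    let ?L = "lattice_disc n"
    have "card (S \<inter> ?L) \<le> card (E \<union> (upper_pts a p \<inter> ?L) \<union> (lower_pts c q \<inter> ?L))"
      by (rule card_mono) (auto simp: S(1,2) finite_lattice_disc)
    also have "\<dots> \<le> card (E \<union> (upper_pts a p \<inter> ?L)) + card (lower_pts c q \<inter> ?L)"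
      by (rule card_Un_le)
    also have "\<dots> \<le> card E + card (upper_pts a p \<inter> ?L) + card (lower_pts c q \<inter> ?L)"
      by (rule add_right_mono card_Un_le)+
    finally show ?thesis using D(2)[of n] D(4)[of n] lower_pts_disc_card[of c q n] by linarith
  qed
  with D show "\<exists>D\<ge>0. \<forall>n. real (card (S \<inter> lattice_disc n)) \<le> 2 * real n + D"
    by (intro exI[of _ "card E + D1 + D2"]) auto
qed

lemma card_disc_split:
  "card ((S \<union> T) \<inter> lattice_disc n) = card ((S \<inter> T) \<inter> lattice_disc n) +
     card ((S - T) \<inter> lattice_disc n) + card ((T - S) \<inter> lattice_disc n)"
proof -
  let ?L = "lattice_disc n"
  have "(S \<union> T) \<inter> ?L = ((S \<inter> T) \<inter> ?L \<union> (S - T) \<inter> ?L) \<union> (T - S) \<inter> ?L" by auto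
  then have "card ((S \<union> T) \<inter> ?L) = card (((S \<inter> T) \<inter> ?L \<union> (S - T) \<inter> ?L) \<union> (T - S) \<inter> ?L)" by simp
  also have "\<dots> = card ((S \<inter> T) \<inter> ?L \<union> (S - T) \<inter> ?L) + card ((T - S) \<inter> ?L)"
    by (rule card_Un_disjoint) (auto simp: finite_lattice_disc)
  also have "card ((S \<inter> T) \<inter> ?L \<union> (S - T) \<inter> ?L) = card ((S \<inter> T) \<inter> ?L) + card ((S - T) \<inter> ?L)"
    by (rule card_Un_disjoint) (auto simp: finite_lattice_disc)
  finally show ?thesis .
qed

lemma staircase_asymptotically_equal:
  assumes "staircase S r s" "staircase T r s"
  shows "asymptotically_equal S T"
  unfolding asymptotically_equal_def
proof (intro conjI)
  show "infinite S" "infinite T" by (rule staircase_disc_bounds(1)[OF assms(1)], rule staircase_disc_bounds(1)[OF assms(2)])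
  let ?i = "\<lambda>n. real (card ((S \<inter> T) \<inter> lattice_disc n))"
    and ?u = "\<lambda>n. real (card ((S \<union> T) \<inter> lattice_disc n))"
  from staircase_disc_bounds(2)[OF assms(1)] obtain D0 where D0: "D0 \<ge> 0"
    "\<And>n. real n / 5 - D0 \<le> real (card (S \<inter> lattice_disc n))" by blast
  have u: "real n / 5 - D0 \<le> ?u n" for n
  proof -
    have "card (S \<inter> lattice_disc n) \<le> card ((S \<union> T) \<inter> lattice_disc n)"
      by (rule card_mono) (auto simp: finite_lattice_disc)
    with D0(2)[of n] show ?thesis by linarith
  qed
  show "(\<lambda>n. ?i n / ?u n) \<longlonglongrightarrow> 1"
  proof (rule LIMSEQ_I)
    fix e :: real assume e: "e > 0"
    then have e20: "e / 20 > 0" by simp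
    from staircase_diff_sublinear[OF assms e20] staircase_diff_sublinear[OF assms(2,1) e20]
    obtain D1 D2 where D: "D1 \<ge> 0" "D2 \<ge> 0"
      "\<And>n. real (card ((S - T) \<inter> lattice_disc n)) \<le> e / 20 * real n + D1"
      "\<And>n. real (card ((T - S) \<inter> lattice_disc n)) \<le> e / 20 * real n + D2" by blast
    \<comment> \<open>The first bound makes the union nonempty. The second makes
      \<open>e / 10 * n\<close> exceed \<open>D1 + D2 + e * D0\<close>, so the two differences, at
      most \<open>e / 10 * n + D1 + D2\<close> together, stay below
      \<open>e * (n / 5 - D0)\<close>.\<close>
    obtain N :: nat where N: "real N > max (5 * D0) (10 * (D1 + D2 + e * D0) / e)"
      using reals_Archimedean2 by blast
    show "\<exists>N. \<forall>n\<ge>N. norm (?i n / ?u n - 1) < e"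
    proof (intro exI allI impI)
      fix n assume "n \<ge> N"
      then have n: "real n > 5 * D0" "real n > 10 * (D1 + D2 + e * D0) / e" using N by auto
      have upos: "?u n > 0" using u[of n] n(1) by linarith
      have split: "?u n = ?i n + real (card ((S - T) \<inter> lattice_disc n)) + real (card ((T - S) \<inter> lattice_disc n))"
        by (simp add: card_disc_split)
      have "?u n - ?i n \<le> e / 10 * real n + (D1 + D2)"
        using split D(3,4)[of n] by (simp add: algebra_simps)
      also have "\<dots> < e * (real n / 5 - D0)"
        using n(2) e by (simp add: field_simps)
      also have "\<dots> \<le> e * ?u n" using u[of n] e by (intro mult_left_mono) auto
      finally have "?u n - ?i n < e * ?u n" .
      moreover have "?i n \<le> ?u n" using split by simp
      ultimately show "norm (?i n / ?u n - 1) < e"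
        using upos e by (simp add: field_simps abs_if)
    qed
  qed
qed

section \<open>Uniqueness of the translation vector\<close>

lemma asymptotically_equal_diff:
  assumes "asymptotically_equal S T" "staircase S r s" "staircase T r' s'" "\<epsilon> > 0"
  shows "\<exists>D\<ge>0. \<forall>n. real (card ((S - T) \<inter> lattice_disc n)) \<le> \<epsilon> * real n + D \<and>
     real (card ((T - S) \<inter> lattice_disc n)) \<le> \<epsilon> * real n + D"
proof -
  let ?i = "\<lambda>n. real (card ((S \<inter> T) \<inter> lattice_disc n))"
    and ?u = "\<lambda>n. real (card ((S \<union> T) \<inter> lattice_disc n))"
  have "(\<lambda>n. ?i n / ?u n) \<longlonglongrightarrow> 1" using assms(1) by (simp add: asymptotically_equal_def)
  from LIMSEQ_D[OF this, of "\<epsilon> / 4"] assms(4) obtain N where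
    N: "\<And>n. n \<ge> N \<Longrightarrow> \<bar>?i n / ?u n - 1\<bar> < \<epsilon> / 4" by auto
  from staircase_disc_bounds(3)[OF assms(2)] staircase_disc_bounds(3)[OF assms(3)] obtain D1 D2
    where D: "D1 \<ge> 0" "\<And>n. real (card (S \<inter> lattice_disc n)) \<le> 2 * real n + D1"
    "D2 \<ge> 0" "\<And>n. real (card (T \<inter> lattice_disc n)) \<le> 2 * real n + D2" by blast
  have u: "?u n \<le> 4 * real n + (D1 + D2)" for n
    using D(2,4)[of n] card_Un_le[of "S \<inter> lattice_disc n" "T \<inter> lattice_disc n"]
    by (simp add: Int_Un_distrib2 flip: of_nat_add)
  \<comment> \<open>The union has at most \<open>4 * n + (D1 + D2)\<close> points, and a share of
    \<open>\<epsilon> / 4\<close> of it differs. The second summand covers \<open>n < N\<close> and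
    the empty union, where the quotient says nothing.\<close>
  define D where "D = \<epsilon> / 4 * (D1 + D2) + (4 * real N + (D1 + D2))"
  have main: "?u n - ?i n \<le> \<epsilon> * real n + D" for n
  proof (cases "n \<ge> N \<and> ?u n > 0")
    case True
    then have "\<bar>?i n / ?u n - 1\<bar> < \<epsilon> / 4" "?u n > 0" using N by auto
    then have "1 - ?i n / ?u n < \<epsilon> / 4" by linarith
    then have "?u n - ?i n < \<epsilon> / 4 * ?u n" using \<open>?u n > 0\<close> by (simp add: field_simps)
    also have "\<dots> \<le> \<epsilon> / 4 * (4 * real n + (D1 + D2))"
      using u[of n] assms(4) by (intro mult_left_mono) auto
    also have "\<dots> \<le> \<epsilon> * real n + D" using D by (simp add: D_def algebra_simps add_divide_distrib)
    finally show ?thesis by simp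
  next
    case False
    have "?u n \<le> 4 * real N + (D1 + D2)"
    proof (cases "n \<ge> N")
      case True
      then have "?u n = 0" using False by linarith
      then show ?thesis using D by simp
    qed (use u[of n] in linarith)
    moreover have "0 \<le> \<epsilon> * real n" "0 \<le> \<epsilon> / 4 * (D1 + D2)" using assms(4) D by auto
    ultimately show ?thesis unfolding D_def by linarith
  qed
  have "real (card ((S - T) \<inter> lattice_disc n)) \<le> \<epsilon> * real n + D"
    "real (card ((T - S) \<inter> lattice_disc n)) \<le> \<epsilon> * real n + D" for n
    using main[of n] by (simp_all add: card_disc_split)
  moreover have "D \<ge> 0" using D assms(4) by (simp add: D_def)
  ultimately show ?thesis by blast
qed

text \<open>\<open>U\<close> has about \<open>n / 5\<close> points in the disc. Passing from
  \<open>S\<close> to \<open>T\<close> and from \<open>T\<close> to \<open>S'\<close> loses about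
  \<open>n / 20\<close> each, so about \<open>n / 10\<close> points remain common.\<close>

lemma common_pts_unbounded:
  assumes S: "staircase S r s" and T: "staircase T r' s'" and S': "staircase S' r'' s''"
    and eq: "asymptotically_equal S T" "asymptotically_equal S' T"
    and U: "U \<subseteq> S" "D0 \<ge> 0" "\<And>n. real n / 5 - D0 \<le> real (card (U \<inter> lattice_disc n))"
  shows "infinite (U \<inter> S')"
proof
  assume fin: "finite (U \<inter> S')"
  from asymptotically_equal_diff[OF eq(1) S T, of "1/20"] obtain D1 where D1:
    "\<And>n. real (card ((S - T) \<inter> lattice_disc n)) \<le> 1/20 * real n + D1" by auto
  from asymptotically_equal_diff[OF eq(2) S' T, of "1/20"] obtain D2 where D2:
    "\<And>n. real (card ((T - S') \<inter> lattice_disc n)) \<le> 1/20 * real n + D2" by auto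
  have *: "real n / 10 \<le> D0 + D1 + D2 + card (U \<inter> S')" for n
  proof -
    let ?L = "lattice_disc n"
    have "card (U \<inter> ?L) \<le> card ((U \<inter> S') \<union> (S - T) \<inter> ?L \<union> (T - S') \<inter> ?L)"
      using U(1) fin by (intro card_mono) (auto simp: finite_lattice_disc)
    also have "\<dots> \<le> card ((U \<inter> S') \<union> (S - T) \<inter> ?L) + card ((T - S') \<inter> ?L)"
      by (rule card_Un_le)
    also have "\<dots> \<le> card (U \<inter> S') + card ((S - T) \<inter> ?L) + card ((T - S') \<inter> ?L)"
      by (rule add_right_mono card_Un_le)+
    finally show ?thesis using U(3)[of n] D1[of n] D2[of n] by linarith
  qed
  obtain n :: nat where "10 * (D0 + D1 + D2 + card (U \<inter> S')) < real n"
    using reals_Archimedean2 by blast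
  with *[of n] show False by (simp add: algebra_simps)
qed

text \<open>A far common point on the upper branch gives \<open>a m = a (m - k) + dx\<close>, one on
  the lower branch \<open>c l = c (l + k) + dy\<close>. If \<open>k > 0\<close>, monotonicity yields
  \<open>dx > 0\<close> and \<open>dy < 0\<close>, against \<open>k = dy - dx\<close>; the case
  \<open>k < 0\<close> is symmetric, and \<open>k = 0\<close> gives the claim.\<close>

lemma staircase_translate_unique:
  assumes S: "staircase S r s" and T: "staircase T r' s'"
    and eq: "asymptotically_equal S T" "asymptotically_equal (translate S (dx, dy)) T"
  shows "dx = 0 \<and> dy = 0"
proof -
  from S obtain a c p q E where *: "finite E" "S = E \<union> upper_pts a p \<union> lower_pts c q"
     "half a c p q r" "half c a q p s" by (auto simp: staircase_def)
  define k where "k = dy - dx"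
  let ?E = "translate E (dx, dy)" and ?a = "\<lambda>n. a (n - k) + dx" and ?c = "\<lambda>n. c (n + k) + dy"
  have finE: "finite ?E" using * by (simp add: translate_conv_image)
  have S': "translate S (dx, dy) = ?E \<union> upper_pts ?a (p + k) \<union> lower_pts ?c (q - k)"
    unfolding upper_pts_translate[OF k_def, symmetric] lower_pts_translate[OF k_def, symmetric]
    unfolding *(2) translate_conv_image image_Un ..
  have sm: "strict_mono_on {p..} a" "strict_mono_on {q..} c" using * by (auto simp: half_def)
  note stS' = staircase_translate[OF S, of dx dy]
  from upper_pts_disc_lower_bound[OF *(3)] obtain D1 where D1: "D1 \<ge> 0"
    "\<And>n. real n / 5 - D1 \<le> real (card (upper_pts a p \<inter> lattice_disc n))" by blast
  from upper_pts_disc_lower_bound[OF *(4)] obtain D2 where D2: "D2 \<ge> 0"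
    "\<And>n. real n / 5 - D2 \<le> real (card (lower_pts c q \<inter> lattice_disc n))"
    unfolding lower_pts_disc_card by blast
  have "infinite (upper_pts a p \<inter> translate S (dx, dy))"
    by (rule common_pts_unbounded[OF S T stS' eq _ D1]) (auto simp: *(2))
  \<comment> \<open>The removed labels are those at which an upper point could lie on the translated
    lower branch, whose points satisfy \<open>y - x \<le> k - q\<close>.\<close>
  then have "infinite ((upper_pts a p \<inter> translate S (dx, dy)) - (?E \<union> (\<lambda>n. (a n, a n + n)) ` {p..k - q}))"
    using finE by (intro Diff_infinite_finite) auto
  then obtain z where "z \<in> (upper_pts a p \<inter> translate S (dx, dy)) - (?E \<union> (\<lambda>n. (a n, a n + n)) ` {p..k - q})"
    by (rule infinite_imp_nonempty[THEN ex_in_conv[THEN iffD2], THEN exE])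
  then have z: "z \<in> upper_pts a p" "z \<in> translate S (dx, dy)" "z \<notin> ?E \<union> (\<lambda>n. (a n, a n + n)) ` {p..k - q}"
    by (simp_all only: Diff_iff Int_iff simp_thms)
  from z(1) obtain m where m: "p \<le> m" "z = (a m, a m + m)" by (auto simp: upper_pts_def)
  then have "m > k - q" using z(3) by auto
  then have "z \<notin> lower_pts ?c (q - k)" using m by (auto simp: lower_pts_def)
  then have "z \<in> upper_pts ?a (p + k)" using z S' by auto
  then have m': "p \<le> m - k" "a m = a (m - k) + dx" using m by (auto simp: upper_pts_def)
  have "infinite (lower_pts c q \<inter> translate S (dx, dy))"
    by (rule common_pts_unbounded[OF S T stS' eq _ D2]) (auto simp: *(2))
  then have "infinite ((lower_pts c q \<inter> translate S (dx, dy)) - (?E \<union> (\<lambda>n. (c n + n, c n)) ` {q..- (p + k)}))"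
    using finE by (intro Diff_infinite_finite) auto
  then obtain w where "w \<in> (lower_pts c q \<inter> translate S (dx, dy)) - (?E \<union> (\<lambda>n. (c n + n, c n)) ` {q..- (p + k)})"
    by (rule infinite_imp_nonempty[THEN ex_in_conv[THEN iffD2], THEN exE])
  then have w: "w \<in> lower_pts c q" "w \<in> translate S (dx, dy)" "w \<notin> ?E \<union> (\<lambda>n. (c n + n, c n)) ` {q..- (p + k)}"
    by (simp_all only: Diff_iff Int_iff simp_thms)
  from w(1) obtain l where l: "q \<le> l" "w = (c l + l, c l)" by (auto simp: lower_pts_def)
  then have "l > - (p + k)" using w(3) by auto
  then have "w \<notin> upper_pts ?a (p + k)" using l by (auto simp: upper_pts_def)
  then have "w \<in> lower_pts ?c (q - k)" using w S' by auto
  then have l': "q \<le> l + k" "c l = c (l + k) + dy" using l by (auto simp: lower_pts_def)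
  consider "k = 0" | "k > 0" | "k < 0" by linarith
  then show ?thesis
  proof cases
    case 1
    have "dx = 0" "dy = 0" using m'(2)[unfolded 1] l'(2)[unfolded 1] by simp_all
    then show ?thesis ..
  next
    case 2
    have "a (m - k) < a m" by (rule strict_mono_onD[OF sm(1)]) (use 2 m(1) m'(1) in auto)
    moreover have "c l < c (l + k)" by (rule strict_mono_onD[OF sm(2)]) (use 2 l(1) l'(1) in auto)
    ultimately show ?thesis using m'(2) l'(2) 2 unfolding k_def by linarith
  next
    case 3
    have "a m < a (m - k)" by (rule strict_mono_onD[OF sm(1)]) (use 3 m(1) m'(1) in auto)
    moreover have "c (l + k) < c l" by (rule strict_mono_onD[OF sm(2)]) (use 3 l(1) l'(1) in auto)
    ultimately show ?thesis using m'(2) l'(2) 3 unfolding k_def by linarith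
  qed
qed

lemma translate_translate:
  "translate (translate S (a, b)) (c, d) = translate S (a + c, b + d)"
  by (simp add: translate_conv_image image_image case_prod_beta add.assoc)

lemma staircase_unique_translation:
  assumes S: "staircase S r s" and T: "staircase T r' s'"
  shows "\<exists>!d. asymptotically_equal (translate S d) T"
proof (rule ex_ex1I)
  have "staircase (translate S (r - r', s - s')) r' s'"
    using staircase_translate[OF S, of "r - r'" "s - s'"] by simp
  then show "\<exists>d. asymptotically_equal (translate S d) T"
    using staircase_asymptotically_equal T by blast
next
  fix d e
  assume eq: "asymptotically_equal (translate S d) T" "asymptotically_equal (translate S e) T"
  obtain d1 d2 e1 e2 where de: "d = (d1, d2)" "e = (e1, e2)" by (cases d, cases e)
  \<comment> \<open>The first translate takes the place of the staircase, and the difference of the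
    vectors that of the translation.\<close>
  have "asymptotically_equal (translate (translate S (d1, d2)) (e1 - d1, e2 - d2)) T"
    using eq(2) by (simp add: translate_translate de)
  then have "e1 - d1 = 0 \<and> e2 - d2 = 0"
    using staircase_translate_unique[OF staircase_translate[OF S] T eq(1)[unfolded de]] by blast
  then show "d = e" by (simp add: de)
qed

subsection \<open>The structure of the P-positions\<close>

text \<open>In the induction the new maximum \<open>b\<close> is at least the number of elements
  below it.\<close>

lemma sum_lessThan_card_le:
  fixes A :: "nat set"
  assumes "finite A"
  shows "\<Sum>{..<card A} \<le> \<Sum>A"
  using assms
proof (induction A rule: finite_linorder_max_induct)
  case (insert b A)
  then have "A \<subseteq> {..<b}" by auto
  then have "card A \<le> b" using card_mono[of "{..<b}" A] by simp
  moreover have "b \<notin> A" using insert by auto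
  ultimately show ?case using insert by simp
qed simp

text \<open>The number of points of \<open>U - W\<close> is fixed while the shift \<open>x - \<psi> x\<close> tends to infinity, so
  \<open>U\<close> gains at most that many points on each long interval.\<close>

lemma density_zero_of_shift:
  fixes U W :: "nat set" and \<psi> :: "nat \<Rightarrow> nat"
  assumes "W \<subseteq> U" "finite (U - W)" "inj_on \<psi> W" "\<psi> ` W \<subseteq> U"
    and less: "\<And>x. x \<in> W \<Longrightarrow> \<psi> x < x"
    and far: "\<And>G. finite {x \<in> W. x \<le> \<psi> x + G}"
  shows "\<exists>C. \<forall>t. q * card (U \<inter> {..<t}) \<le> t + C"
proof -
  let ?u = "\<lambda>t. card (U \<inter> {..<t})"
  \<comment> \<open>\<open>G\<close> pays for \<open>q\<close> times the gain of one step of length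
    \<open>G\<close>; \<open>Suc\<close> keeps the step positive, so that the induction descends.
    From \<open>T\<close> on every shift exceeds \<open>G\<close>.\<close>
  define G where "G = Suc (q * card (U - W))"
  obtain T where T: "\<And>x. x \<in> W \<Longrightarrow> x \<le> \<psi> x + G \<Longrightarrow> x < T"
    using far[of G] by (auto simp: finite_nat_set_iff_bounded)
  have step: "?u t \<le> card (U - W) + ?u (t - G)" if t: "t \<ge> T + G" for t
  proof -
    have "\<psi> ` (W \<inter> {..<t}) \<subseteq> U \<inter> {..<t - G}"
    proof (clarify, intro IntI)
      fix x assume x: "x \<in> W" "x < t"
      then show "\<psi> x \<in> U" using assms by auto
      \<comment> \<open>If the shift is at most \<open>G\<close>, then
        \<open>x < T \<le> t - G\<close> and \<open>\<psi> x < x\<close> suffices; otherwise the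
        shift itself brings \<open>x < t\<close> below \<open>t - G\<close>.\<close>
      show "\<psi> x \<in> {..<t - G}"
        using T[OF x(1)] less[OF x(1)] t x(2) by (cases "x \<le> \<psi> x + G") auto
    qed
    then have "card (W \<inter> {..<t}) \<le> ?u (t - G)"
      using assms(3) by (intro card_inj_on_le[of \<psi>]) (auto intro: inj_on_subset)
    moreover have "?u t \<le> card ((U - W) \<union> (W \<inter> {..<t}))"
      using assms(2) by (intro card_mono) auto
    ultimately show ?thesis
      using card_Un_le[of "U - W" "W \<inter> {..<t}"] by linarith
  qed
  have "q * ?u t \<le> t + q * (T + G)" for t
  proof (induction t rule: less_induct)
    case (less t)
    show ?case
    proof (cases "t \<ge> T + G")
      case True
      have "q * ?u t \<le> q * card (U - W) + q * ?u (t - G)"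
        using mult_le_mono2[OF step[OF True], of q] by (simp add: add_mult_distrib2)
      moreover have "q * ?u (t - G) \<le> (t - G) + q * (T + G)"
        using True by (intro less.IH) (auto simp: G_def)
      moreover have "q * card (U - W) \<le> G" by (simp add: G_def)
      ultimately show ?thesis using True by linarith
    next
      case False
      have "?u t \<le> card {..<t}" by (intro card_mono) auto
      then have "q * ?u t \<le> q * (T + G)" using False by (intro mult_le_mono2) auto
      then show ?thesis by linarith
    qed
  qed
  then show ?thesis by blast
qed

text \<open>The condition \<open>1 \<le> p\<close> keeps the main diagonal out, so the enumerations
  for \<open>P\<close> and for its transpose describe disjoint sets of positions.\<close>

definition diag_enum :: "(nat \<Rightarrow> nat \<Rightarrow> bool) \<Rightarrow> nat \<Rightarrow> (nat \<Rightarrow> nat) \<Rightarrow> bool" where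
  "diag_enum P p \<alpha> \<longleftrightarrow> 1 \<le> p \<and> strict_mono_on {p..} \<alpha> \<and> (\<forall>n\<ge>p. \<forall>x. P x (x + n) \<longleftrightarrow> x = \<alpha> n) \<and>
     finite {(x, y). P x y \<and> x < y \<and> y < x + p}"

text \<open>Inside the square of side \<open>K\<close> the predicate is arbitrary, which models the
  alteration. The condition is symmetric in the coordinates, so results above the diagonal carry
  over to those below it by transposing.\<close>

definition eventually_wythoff :: "(nat \<Rightarrow> nat \<Rightarrow> bool) \<Rightarrow> nat \<Rightarrow> bool" where
  "eventually_wythoff P K \<longleftrightarrow> (\<forall>x y. K \<le> x \<or> K \<le> y \<longrightarrow>
    (P x y \<longleftrightarrow> (\<forall>k\<ge>1. (k \<le> x \<longrightarrow> \<not> P (x - k) y) \<and> (k \<le> y \<longrightarrow> \<not> P x (y - k)) \<and>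
      (k \<le> x \<and> k \<le> y \<longrightarrow> \<not> P (x - k) (y - k)))))"

lemma eventually_wythoff_swap: "eventually_wythoff P K \<Longrightarrow> eventually_wythoff (\<lambda>x y. P y x) K"
  unfolding eventually_wythoff_def by blast

context
  fixes P :: "nat \<Rightarrow> nat \<Rightarrow> bool" and K :: nat
  assumes wythoff: "eventually_wythoff P K"
begin

lemma rec: "K \<le> x \<or> K \<le> y \<Longrightarrow>
    P x y \<longleftrightarrow> (\<forall>k\<ge>1. (k \<le> x \<longrightarrow> \<not> P (x - k) y) \<and> (k \<le> y \<longrightarrow> \<not> P x (y - k)) \<and>
      (k \<le> x \<and> k \<le> y \<longrightarrow> \<not> P (x - k) (y - k)))"
  using wythoff unfolding eventually_wythoff_def by blast

text \<open>The forbidden move starts at the larger position, so only this one is required to lie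
  outside the square; likewise for columns and diagonals.\<close>

lemma row_less:
  assumes "P x y" "P x' y" "K \<le> x' \<or> K \<le> y"
  shows "\<not> x < x'"
proof
  assume "x < x'"
  then have "x' - (x' - x) = x" "1 \<le> x' - x" "x' - x \<le> x'" by auto
  then show False using rec[OF assms(3)] assms(1,2) by metis
qed

lemma col_less:
  assumes "P x y" "P x y'" "K \<le> x \<or> K \<le> y'"
  shows "\<not> y < y'"
proof
  assume "y < y'"
  then have "y' - (y' - y) = y" "1 \<le> y' - y" "y' - y \<le> y'" by auto
  then show False using rec[OF assms(3)] assms(1,2) by metis
qed

lemma diag_less:
  assumes "P x y" "P x' y'" "x' + y = x + y'" "K \<le> x' \<or> K \<le> y'"
  shows "\<not> x < x'"
proof
  assume "x < x'"
  then have "x' - (x' - x) = x" "y' - (x' - x) = y" "1 \<le> x' - x" "x' - x \<le> x'" "x' - x \<le> y'"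
    using assms(3) by auto
  then show False using rec[OF assms(4)] assms(1,2) by metis
qed

lemma col_unique: "P x y \<Longrightarrow> P x y' \<Longrightarrow> K \<le> x \<Longrightarrow> y = y'"
  using col_less[of x y y'] col_less[of x y' y] by linarith

lemma diag_unique: "P x (x + d) \<Longrightarrow> P x' (x' + d) \<Longrightarrow> K \<le> x \<Longrightarrow> K \<le> x' \<Longrightarrow> x = x'"
  using diag_less[of x "x + d" x' "x' + d"] diag_less[of x' "x' + d" x "x + d"] by linarith

lemma reach:
  assumes "\<not> P x y" "K \<le> x \<or> K \<le> y"
  obtains x' where "x' < x" "P x' y" | y' where "y' < y" "P x y'"
  | x' y' where "x' < x" "y' < y" "P x' y'" "x' + y = x + y'"
proof -
  from rec[OF assms(2)] assms(1) obtain k where k: "k \<ge> 1"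
    "k \<le> x \<and> P (x - k) y \<or> k \<le> y \<and> P x (y - k) \<or> k \<le> x \<and> k \<le> y \<and> P (x - k) (y - k)" by blast
  then consider "k \<le> x" "P (x - k) y" | "k \<le> y" "P x (y - k)" | "k \<le> x" "k \<le> y" "P (x - k) (y - k)"
    by blast
  then show ?thesis
    by cases (use that(1)[of "x - k"] that(2)[of "y - k"] that(3)[of "x - k" "y - k"] k(1) in auto)
qed

lemma finite_col: "finite {y. P x y}"
proof -
  have "finite {y. K \<le> y \<and> P x y}"
  proof (cases "\<exists>y\<ge>K. P x y")
    case True
    then obtain y where y: "K \<le> y" "P x y" by blast
    have "{y. K \<le> y \<and> P x y} \<subseteq> {y}"
    proof clarify
      fix z assume "K \<le> z" "P x z"
      then show "z = y" using col_less[of x y z] col_less[of x z y] y by linarith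
    qed
    then show ?thesis using finite_subset by blast
  next
    case False
    then have "{y. K \<le> y \<and> P x y} = {}" by blast
    then show ?thesis by (simp only: finite.emptyI)
  qed
  moreover have "{y. P x y} \<subseteq> {..<K} \<union> {y. K \<le> y \<and> P x y}" by auto
  ultimately show ?thesis by (meson finite_UnI finite_lessThan finite_subset)
qed

lemma finite_cols: "finite {(x, y). x < m \<and> P x y}"
proof -
  have "{(x, y). x < m \<and> P x y} = Sigma {..<m} (\<lambda>x. {y. P x y})" by auto
  then show ?thesis by (simp add: finite_col)
qed

lemma finite_small_diag: "finite {x. \<exists>d\<le>D. P x (x + d)}"
proof -
  have "finite {x. K \<le> x \<and> P x (x + d)}" for d
  proof (cases "\<exists>x\<ge>K. P x (x + d)")
    case True
    then obtain x where x: "K \<le> x" "P x (x + d)" by blast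
    then have "{x. K \<le> x \<and> P x (x + d)} \<subseteq> {x}" using diag_unique by blast
    then show ?thesis using finite_subset by blast
  next
    case False
    then have "{x. K \<le> x \<and> P x (x + d)} = {}" by blast
    then show ?thesis by (simp only: finite.emptyI)
  qed
  then have "finite ({..<K} \<union> (\<Union>d\<in>{..D}. {x. K \<le> x \<and> P x (x + d)}))"
    by (intro finite_UnI finite_UN_I finite_lessThan finite_atMost)
  moreover have "{x. \<exists>d\<le>D. P x (x + d)} \<subseteq> {..<K} \<union> (\<Union>d\<in>{..D}. {x. K \<le> x \<and> P x (x + d)})"
  proof
    fix x assume "x \<in> {x. \<exists>d\<le>D. P x (x + d)}"
    then obtain d where "d \<le> D" "P x (x + d)" by blast
    then show "x \<in> {..<K} \<union> (\<Union>d\<in>{..D}. {x. K \<le> x \<and> P x (x + d)})"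
      by (cases "x < K") (simp, blast intro: leI)
  qed
  ultimately show ?thesis by (rule rev_finite_subset)
qed

text \<open>Let \<open>b\<close> bound the heights in all earlier columns. In an empty column the
  cell \<open>(x, b + x)\<close> would have to be blocked from an earlier column, but a row or
  diagonal move from it to such a column ends at height at least \<open>b\<close>.\<close>

lemma col_exists: "K \<le> x \<Longrightarrow> \<exists>y. P x y"
proof (rule ccontr)
  assume x: "K \<le> x" and no: "\<nexists>y. P x y"
  have "finite (snd ` {(x', y). x' < x \<and> P x' y})" using finite_cols by blast
  then obtain b where "\<forall>y \<in> snd ` {(x', y). x' < x \<and> P x' y}. y < b"
    by (auto simp: finite_nat_set_iff_bounded)
  then have b: "y < b" if "x' < x" "P x' y" for x' y using that by force
  have "\<not> P x (b + x)" using no by blast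
  then show False
  proof (rule reach)
    fix x' y' assume "x' < x" "P x' y'" "x' + (b + x) = x + y'"
    then show False using b[of x' y'] by linarith
  next
    fix x' assume "x' < x" "P x' (b + x)"
    then show False using b[of x' "b + x"] by linarith
  qed (use x no in auto)
qed

section \<open>Used differences and holes\<close>

definition used :: "nat \<Rightarrow> nat set" where
  "used m = {d. 1 \<le> d \<and> (\<exists>x<m. P x (x + d))}"

definition holes :: "nat \<Rightarrow> nat set" where
  "holes m = {d. 1 \<le> d \<and> d \<notin> used m \<and> (\<exists>e\<in>used m. d < e)}"

lemma finite_used: "finite (used m)"
proof (rule finite_subset)
  show "used m \<subseteq> (\<lambda>(x, y). y - x) ` {(x, y). x < m \<and> P x y}"
    by (force simp: used_def)
qed (use finite_cols in blast)

lemma finite_holes: "finite (holes m)"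
proof (rule finite_subset)
  show "holes m \<subseteq> {..Max (used m)}"
    using finite_used by (auto simp: holes_def intro: Max_ge order_trans[OF less_imp_le])
qed simp

lemma used_mono: "m \<le> m' \<Longrightarrow> used m \<subseteq> used m'"
  by (force simp: used_def)

text \<open>If column \<open>m\<close> passes over an unused difference \<open>h\<close>, then \<open>(m, m + h)\<close> is blocked by a row,
  hence by an earlier position with a difference larger than \<open>h\<close>.\<close>

lemma holes_Suc: "K \<le> m \<Longrightarrow> holes (Suc m) \<subseteq> holes m"
proof
  fix h assume m: "K \<le> m" and h: "h \<in> holes (Suc m)"
  have sub: "used m \<subseteq> used (Suc m)" by (simp add: used_mono)
  from h obtain e where e: "1 \<le> h" "h \<notin> used (Suc m)" "e \<in> used (Suc m)" "h < e"
    by (auto simp: holes_def)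
  have "\<exists>e\<in>used m. h < e"
  proof (rule ccontr)
    assume no: "\<not> (\<exists>e\<in>used m. h < e)"
    then have "e \<notin> used m" using e by blast
    then have Pe: "P m (m + e)" using e(3) by (auto simp: used_def less_Suc_eq)
    have "\<not> P m (m + h)" using e(1,2) by (auto simp: used_def)
    then show False
    proof (rule reach)
      show "K \<le> m \<or> K \<le> m + h" using m by simp
    next
      fix x' assume "x' < m" "P x' (m + h)"
      then have "m + h - x' \<in> used m" "h < m + h - x'" by (auto simp: used_def intro!: exI[of _ x'])
      then show False using no by blast
    next
      fix y' assume "y' < m + h" "P m y'"
      then show False using col_less[OF _ Pe, of y'] m e by simp
    next
      fix x' y' assume "x' < m" "P x' y'" "x' + (m + h) = m + y'"
      moreover from this have "y' = x' + h" by linarith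
      ultimately have "P x' (x' + h)" by simp
      then have "h \<in> used m" using \<open>x' < m\<close> e(1) by (auto simp: used_def)
      then show False using sub e(2) by blast
    qed
  qed
  then show "h \<in> holes m" using e sub by (auto simp: holes_def)
qed

lemma holes_antimono:
  assumes "K \<le> m" "m \<le> m'"
  shows "holes m' \<subseteq> holes m"
  using assms(2)
proof (induction m' rule: dec_induct)
  case (step i)
  then show ?case using holes_Suc[of i] assms(1) by auto
qed simp

text \<open>The rows \<open>y\<close> and the differences \<open>x - y\<close> of the positions counted by \<open>n T\<close> are two families of
  distinct numbers, and together they sum to the sum of the columns.\<close>

lemma lower_cols_bound:
  defines "n \<equiv> \<lambda>T. card {x. K \<le> x \<and> x < T \<and> (\<exists>y<x. P x y)}"
  shows "2 * (n T * n T) \<le> T * T + T"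
proof -
  let ?Z = "{x. K \<le> x \<and> x < T \<and> (\<exists>y<x. P x y)}"
  have nT: "n T \<le> T" using card_mono[of "{..<T}" ?Z] by (auto simp: n_def)
  define f where "f x = (SOME y. y < x \<and> P x y)" for x
  have f: "f x < x \<and> P x (f x)" if "x \<in> ?Z" for x
  proof -
    have "\<exists>y. y < x \<and> P x y" using that by auto
    then show ?thesis unfolding f_def by (rule someI_ex)
  qed
  have inj1: "inj_on f ?Z"
  proof (rule inj_onI)
    fix x x' assume x: "x \<in> ?Z" "x' \<in> ?Z" "f x = f x'"
    then show "x = x'"
      using f[OF x(1)] f[OF x(2)] row_less[of x "f x" x'] row_less[of x' "f x'" x] by auto
  qed
  have inj2: "inj_on (\<lambda>x. x - f x) ?Z"
  proof (rule inj_onI)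
    fix x x' assume x: "x \<in> ?Z" "x' \<in> ?Z" and "x - f x = x' - f x'"
    then have "x + f x' = x' + f x" "x' + f x = x + f x'" using f[OF x(1)] f[OF x(2)] by auto
    then have "\<not> x < x'" "\<not> x' < x"
      using diag_less[of x "f x" x' "f x'"] diag_less[of x' "f x'" x "f x"] f x by auto
    then show "x = x'" by simp
  qed
  have "\<Sum>{..<n T} \<le> \<Sum>(f ` ?Z)" "\<Sum>{..<n T} \<le> \<Sum>((\<lambda>x. x - f x) ` ?Z)"
    using sum_lessThan_card_le[of "f ` ?Z"] sum_lessThan_card_le[of "(\<lambda>x. x - f x) ` ?Z"]
    by (simp_all add: card_image inj1 inj2 n_def)
  then have "2 * \<Sum>{..<n T} \<le> (\<Sum>x\<in>?Z. f x) + (\<Sum>x\<in>?Z. x - f x)"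
    by (simp add: sum.reindex[OF inj1] sum.reindex[OF inj2])
  also have "\<dots> = \<Sum>?Z"
    unfolding sum.distrib[symmetric]
  proof (rule sum.cong[OF refl])
    fix x assume "x \<in> ?Z"
    from f[OF this] show "f x + (x - f x) = x" by simp
  qed
  also have "\<dots> \<le> \<Sum>{..<T}" by (intro sum_mono2) auto
  \<comment> \<open>In closed form this is \<open>2 * (n^2 - n) \<le> T^2 - T\<close> with
    \<open>n\<close> for \<open>n T\<close>; then \<open>n T \<le> T\<close> gives the
    claim.\<close>
  finally have "2 * (2 * \<Sum>{..<n T}) \<le> 2 * \<Sum>{..<T}" by simp
  moreover have gauss: "2 * \<Sum>{..<k} + k = k * k" for k :: nat
    by (induction k) auto
  ultimately show ?thesis using gauss[of T] gauss[of "n T"] nT by linarith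
qed

text \<open>If the difference \<open>h\<close> never occurs, then almost every column with a position above the diagonal
  is blocked at height \<open>x + h\<close> by a row. The blocking column \<open>\<psi> x\<close> shows that such columns have
  density zero, although \<open>lower_cols_bound\<close> gives them positive density.\<close>

lemma all_used:
  assumes "1 \<le> h"
  shows "\<exists>x. P x (x + h)"
proof (rule ccontr)
  assume no: "\<nexists>x. P x (x + h)"
  define U where "U = {x. K \<le> x \<and> (\<exists>d\<ge>1. P x (x + d))}"
  define \<psi> where "\<psi> x = (SOME x'. x' < x \<and> P x' (x + h))" for x
  have \<psi>: "\<psi> x < x \<and> P (\<psi> x) (x + h)" if x: "K \<le> x" "P x (x + d)" "h < d" for x d
  proof -
    have "\<not> P x (x + h)" using no by blast
    then have "\<exists>x'<x. P x' (x + h)"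
    proof (rule reach)
      fix y' assume "y' < x + h" "P x y'"
      then show ?thesis using col_less[OF _ x(2), of y'] x by simp
    next
      fix x' y' assume "P x' y'" "x' + (x + h) = x + y'"
      moreover from this have "y' = x' + h" by linarith
      ultimately have "P x' (x' + h)" by simp
      then show ?thesis using no by blast
    qed (use x in auto)
    then show ?thesis unfolding \<psi>_def by (rule someI_ex)
  qed
  \<comment> \<open>Only finitely many columns of \<open>U\<close> are left out: those with a
    difference at most \<open>h\<close>, and those blocked from a column before \<open>K\<close>,
    since these columns hold finitely many positions.\<close>
  define W where "W = {x \<in> U. (\<exists>d>h. P x (x + d)) \<and> K \<le> \<psi> x}"
  have W: "\<psi> x < x" "P (\<psi> x) (x + h)" "K \<le> \<psi> x" if "x \<in> W" for x
    using that \<psi>[of x] by (auto simp: W_def U_def)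
  have inj: "inj_on \<psi> W"
  proof (rule inj_onI)
    fix x y assume "x \<in> W" "y \<in> W" "\<psi> x = \<psi> y"
    then show "x = y" using W[of x] W[of y] col_unique[of "\<psi> x" "x + h" "y + h"] by simp
  qed
  have "\<exists>C. \<forall>t. 5 * card (U \<inter> {..<t}) \<le> t + C"
  proof (rule density_zero_of_shift)
    show "W \<subseteq> U" by (auto simp: W_def)
    show "inj_on \<psi> W" by (rule inj)
    show "\<psi> ` W \<subseteq> U"
    proof clarify
      fix x assume "x \<in> W"
      then show "\<psi> x \<in> U"
        using W[of x] by (auto simp: U_def intro!: exI[of _ "x + h - \<psi> x"])
    qed
    show "\<psi> x < x" if "x \<in> W" for x using W that by blast
    have "U - W \<subseteq> {x. \<exists>d\<le>h. P x (x + d)} \<union> (\<lambda>(x', y). y - h) ` {(x', y). x' < K \<and> P x' y}"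
    proof
      fix x assume x: "x \<in> U - W"
      then obtain d where d: "K \<le> x" "P x (x + d)" by (auto simp: U_def)
      show "x \<in> {x. \<exists>d\<le>h. P x (x + d)} \<union> (\<lambda>(x', y). y - h) ` {(x', y). x' < K \<and> P x' y}"
      proof (cases "h < d")
        case True
        then have "\<not> K \<le> \<psi> x" using x d by (auto simp: W_def)
        then show ?thesis using \<psi>[OF d True]
          by (intro UnI2 image_eqI[of _ _ "(\<psi> x, x + h)"]) auto
      next
        case False
        then show ?thesis using d by (intro UnI1) (auto simp: not_less)
      qed
    qed
    then show "finite (U - W)"
      by (rule finite_subset) (intro finite_UnI finite_small_diag finite_imageI finite_cols)
    fix G
    \<comment> \<open>A shift of at most \<open>G\<close> gives the blocking position a difference
      of at most \<open>h + G\<close>, and such positions lie in finitely many columns.\<close>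
    have "\<psi> ` {x \<in> W. x \<le> \<psi> x + G} \<subseteq> {x. \<exists>d\<le>h + G. P x (x + d)}"
    proof clarify
      fix x assume x: "x \<in> W" "x \<le> \<psi> x + G"
      then show "\<exists>d\<le>h + G. P (\<psi> x) (\<psi> x + d)"
        using W[of x] by (intro exI[of _ "x + h - \<psi> x"]) auto
    qed
    then have "finite (\<psi> ` {x \<in> W. x \<le> \<psi> x + G})"
      by (rule finite_subset) (rule finite_small_diag)
    then show "finite {x \<in> W. x \<le> \<psi> x + G}"
      by (rule finite_imageD) (use inj in \<open>auto intro: inj_on_subset\<close>)
  qed
  then obtain C where C: "\<And>t. 5 * card (U \<inter> {..<t}) \<le> t + C" by blast
  \<comment> \<open>\<open>C'\<close> also absorbs the columns before \<open>K\<close> and the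
    single column that may meet the main diagonal. With \<open>T = 4 * C'\<close> at least
    \<open>3 / 4 * T\<close> columns have a position below the diagonal. As
    \<open>2 * (3/4)^2 > 1\<close> and \<open>C' \<ge> 5\<close>, this contradicts
    \<open>lower_cols_bound\<close>.\<close>
  define C' where "C' = C + 5 * K + 5"
  define T where "T = 4 * C'"
  define n where "n = card {x. K \<le> x \<and> x < T \<and> (\<exists>y<x. P x y)}"
  have "{K..<T} \<subseteq> (U \<inter> {..<T}) \<union> {x. K \<le> x \<and> x < T \<and> (\<exists>y<x. P x y)} \<union> {x. K \<le> x \<and> P x (x + 0)}"
  proof
    fix x assume x: "x \<in> {K..<T}"
    then obtain y where y: "P x y" using col_exists by auto
    consider "x < y" | "y < x" | "x = y" by linarith
    then show "x \<in> (U \<inter> {..<T}) \<union> {x. K \<le> x \<and> x < T \<and> (\<exists>y<x. P x y)} \<union> {x. K \<le> x \<and> P x (x + 0)}"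
    proof cases
      case 1
      then show ?thesis using x y by (auto simp: U_def intro!: exI[of _ "y - x"])
    qed (use x y in auto)
  qed
  moreover have diag: "finite {x. K \<le> x \<and> P x (x + 0)}"
    by (rule finite_subset[OF _ finite_small_diag[of 0]]) auto
  moreover have "card {x. K \<le> x \<and> P x (x + 0)} \<le> 1"
    unfolding One_nat_def card_le_Suc0_iff_eq[OF diag] using diag_unique by blast
  ultimately have "T - K \<le> card (U \<inter> {..<T}) + n + 1"
    using card_mono[of "(U \<inter> {..<T}) \<union> {x. K \<le> x \<and> x < T \<and> (\<exists>y<x. P x y)} \<union> {x. K \<le> x \<and> P x (x + 0)}" "{K..<T}"]
      card_Un_le[of "U \<inter> {..<T}" "{x. K \<le> x \<and> x < T \<and> (\<exists>y<x. P x y)}"]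
      card_Un_le[of "(U \<inter> {..<T}) \<union> {x. K \<le> x \<and> x < T \<and> (\<exists>y<x. P x y)}" "{x. K \<le> x \<and> P x (x + 0)}"]
    unfolding n_def by simp
  then have "5 * n \<ge> 15 * C'" using C[of T] T_def C'_def by linarith
  then have "n \<ge> 3 * C'" by simp
  then have "2 * (n * n) \<ge> 2 * (3 * C' * (3 * C'))" by (intro mult_le_mono) auto
  then have "18 * (C' * C') \<le> 2 * (n * n)" by simp
  also have "\<dots> \<le> T * T + T"
    using lower_cols_bound[of T] by (simp add: n_def)
  also have "\<dots> = 16 * (C' * C') + 4 * C'" by (simp add: T_def)
  finally have "2 * (C' * C') \<le> 4 * C'" by linarith
  moreover have "C' \<ge> 5" by (simp add: C'_def)
  moreover from this have "5 * C' \<le> C' * C'" by (intro mult_le_mono) auto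
  ultimately show False by linarith
qed

text \<open>By \<open>all_used\<close> the finitely many holes at \<open>K\<close> are filled in the
  end, and no new ones arise. Once there are none, the used differences are those from 1 to
  \<open>p - 1\<close>, and taking a later difference out of order would create a hole.\<close>

lemma diag_enum_exists: "\<exists>p \<alpha>. diag_enum P p \<alpha>"
proof -
  have "\<exists>m\<ge>K. holes m = {}"
  proof -
    have "\<forall>h\<in>holes K. \<exists>x. P x (x + h)" using all_used by (auto simp: holes_def)
    then obtain g where g: "\<And>h. h \<in> holes K \<Longrightarrow> P (g h) (g h + h)" by metis
    \<comment> \<open>All holes present at \<open>K\<close> are filled by columns before
      \<open>b\<close>.\<close>
    obtain b where "\<forall>x \<in> g ` holes K. x < b"
      using finite_imageI[OF finite_holes, of g] finite_nat_set_iff_bounded by blast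
    then have b: "g h < b" if "h \<in> holes K" for h using that by blast
    have "h \<in> used (max K b)" if "h \<in> holes K" for h
    proof -
      have "g h < max K b" "1 \<le> h" using b[OF that] that by (auto simp: holes_def)
      then show ?thesis unfolding used_def using g[OF that] by blast
    qed
    then have "holes (max K b) = {}"
      using holes_antimono[of K "max K b"] holes_def[of "max K b"] by auto
    then show ?thesis by (intro exI[of _ "max K b"]) auto
  qed
  then obtain m where m: "K \<le> m" "holes m = {}" by blast
  define p where "p = (LEAST d. 1 \<le> d \<and> d \<notin> used m)"
  have "\<exists>d. 1 \<le> d \<and> d \<notin> used m"
  proof -
    obtain b where "\<forall>d\<in>used m. d < b" using finite_used[of m] by (auto simp: finite_nat_set_iff_bounded)
    then show ?thesis by (intro exI[of _ "Suc b"]) auto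
  qed
  then have p: "1 \<le> p \<and> p \<notin> used m"
    using LeastI_ex[of "\<lambda>d. 1 \<le> d \<and> d \<notin> used m"] by (simp add: p_def)
  have used_less: "d \<in> used m \<longleftrightarrow> 1 \<le> d \<and> d < p" for d
  proof
    assume d: "d \<in> used m"
    then have "\<not> p < d" using m(2) p by (auto simp: holes_def)
    moreover have "d \<noteq> p" using d p by auto
    ultimately show "1 \<le> d \<and> d < p" using d by (auto simp: used_def)
  next
    assume "1 \<le> d \<and> d < p"
    then show "d \<in> used m"
      using not_less_Least[of d "\<lambda>d. 1 \<le> d \<and> d \<notin> used m"] by (simp add: p_def)
  qed
  define \<alpha> where "\<alpha> n = (SOME x. P x (x + n))" for n
  have \<alpha>: "P (\<alpha> n) (\<alpha> n + n)" if "p \<le> n" for n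
    unfolding \<alpha>_def using someI_ex[OF all_used[of n]] that p by simp
  have large: "m \<le> x" if "P x (x + n)" "p \<le> n" for x n
  proof (rule ccontr)
    assume "\<not> m \<le> x"
    then have "x < m" "1 \<le> n" using that p by auto
    then have "n \<in> used m" using that unfolding used_def by blast
    then show False using that used_less by simp
  qed
  have iff: "P x (x + n) \<longleftrightarrow> x = \<alpha> n" if "p \<le> n" for x n
  proof
    assume "P x (x + n)"
    then show "x = \<alpha> n"
      using diag_unique \<alpha>[OF that] large[OF _ that] m(1) by (meson order_trans)
  qed (use \<alpha>[OF that] in simp)
  have "strict_mono_on {p..} \<alpha>"
  proof (rule strict_mono_onI)
    fix n n' assume n: "n \<in> {p..}" "n' \<in> {p..}" "n < n'"
    have P: "P (\<alpha> n) (\<alpha> n + n)" "P (\<alpha> n') (\<alpha> n' + n')" using n \<alpha> by auto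
    then have ge: "m \<le> \<alpha> n" "m \<le> \<alpha> n'" using n large by auto
    have "\<alpha> n \<noteq> \<alpha> n'" using col_unique[of "\<alpha> n" "\<alpha> n + n" "\<alpha> n' + n'"] P ge m n by auto
    moreover have "\<not> \<alpha> n' < \<alpha> n"
    proof
      assume lt: "\<alpha> n' < \<alpha> n"
      have "n' \<in> used (Suc (\<alpha> n'))" using P n p by (auto simp: used_def)
      moreover have "n \<notin> used (Suc (\<alpha> n'))" using iff[of n] n lt by (auto simp: used_def)
      ultimately have "n \<in> holes (Suc (\<alpha> n'))" using n p by (auto simp: holes_def)
      then show False using holes_antimono[of m "Suc (\<alpha> n')"] m ge by auto
    qed
    ultimately show "\<alpha> n < \<alpha> n'" by linarith
  qed
  \<comment> \<open>Each difference below \<open>p\<close> already occurs before column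
    \<open>m\<close>, and \<open>diag_less\<close> forbids a repetition from \<open>m\<close>
    on.\<close>
  moreover have "finite {(x, y). P x y \<and> x < y \<and> y < x + p}"
  proof (rule finite_subset)
    show "{(x, y). P x y \<and> x < y \<and> y < x + p} \<subseteq> {(x, y). x < m \<and> P x y}"
    proof clarify
      fix x y assume xy: "P x y" "x < y" "y < x + p"
      then have "y - x \<in> used m" unfolding used_less by linarith
      then obtain x0 where x0: "x0 < m" "P x0 (x0 + (y - x))" by (auto simp: used_def)
      show "x < m"
      proof (rule ccontr)
        assume "\<not> x < m"
        then show False
          using diag_less[OF x0(2) xy(1)] x0(1) xy(2) m(1) by linarith
      qed
    qed
  qed (rule finite_cols)
  ultimately have "diag_enum P p \<alpha>" using iff p unfolding diag_enum_def by blast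
  then show ?thesis by blast
qed

text \<open>A column far to the right holds exactly one position, and its difference is large enough
  to be enumerated by \<open>\<alpha>\<close> or by \<open>\<beta>\<close>. So the first coordinates
  of the two branches partition the large integers.\<close>

lemma half_exists:
  assumes \<alpha>: "diag_enum P p \<alpha>" and \<beta>: "diag_enum (\<lambda>x y. P y x) q \<beta>"
  shows "\<exists>r. half (\<lambda>n. int (\<alpha> (nat n))) (\<lambda>n. int (\<beta> (nat n))) (int p) (int q) r"
proof -
  have P_upper: "P x (x + n) \<longleftrightarrow> x = \<alpha> n" if "p \<le> n" for x n
    using \<alpha> that by (auto simp: diag_enum_def)
  have P_lower: "P (x + n) x \<longleftrightarrow> x = \<beta> n" if "q \<le> n" for x n
    using \<beta> that by (auto simp: diag_enum_def)
  have pq: "1 \<le> p" "1 \<le> q" using \<alpha> \<beta> by (auto simp: diag_enum_def)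
  have sm: "strict_mono_on {int p..} (\<lambda>n. int (\<alpha> (nat n)))" "strict_mono_on {int q..} (\<lambda>n. int (\<beta> (nat n)))"
    using \<alpha> \<beta> by (auto simp: diag_enum_def intro!: strict_mono_onI elim!: strict_mono_onD)
  have "finite {(y, x). P x y \<and> y < x \<and> x < y + q}" using \<beta> by (simp add: diag_enum_def)
  then have "finite (prod.swap ` {(y, x). P x y \<and> y < x \<and> x < y + q})" by (rule finite_imageI)
  moreover have "prod.swap ` {(y, x). P x y \<and> y < x \<and> x < y + q} = {(x, y). P x y \<and> y < x \<and> x < y + q}"
    by auto
  ultimately have "finite {(x, y). P x y \<and> y < x \<and> x < y + q}" by simp
  moreover have "finite {(x, y). P x y \<and> x < y \<and> y < x + p}"
    using \<alpha> by (simp add: diag_enum_def)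
  moreover have "finite {x. P x x}"
    by (rule finite_subset[OF _ finite_small_diag[of 0]]) auto
  ultimately have "finite (fst ` {(x, y). P x y \<and> y < x \<and> x < y + q} \<union>
      fst ` {(x, y). P x y \<and> x < y \<and> y < x + p} \<union> {x. P x x})" by simp
  \<comment> \<open>From \<open>b\<close> on no column holds a position on the main diagonal or with
    a difference too small for the enumerations.\<close>
  then obtain b where b0: "\<forall>x \<in> fst ` {(x, y). P x y \<and> y < x \<and> x < y + q} \<union>
      fst ` {(x, y). P x y \<and> x < y \<and> y < x + p} \<union> {x. P x x}. x < b"
    using finite_nat_set_iff_bounded by meson
  have b: "y + q \<le> x \<or> x + p \<le> y" if "P x y" "b \<le> x" for x y
  proof (rule ccontr)
    assume "\<not> ?thesis"
    then consider "y < x \<and> x < y + q" | "x < y \<and> y < x + p" | "x = y" by linarith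
    then have "x < b"
    proof cases
      case 1
      then have "(x, y) \<in> {(x, y). P x y \<and> y < x \<and> x < y + q}" using that(1) by simp
      then have "x \<in> fst ` {(x, y). P x y \<and> y < x \<and> x < y + q}" by (rule image_eqI[rotated]) simp
      then show ?thesis using b0 by blast
    next
      case 2
      then have "(x, y) \<in> {(x, y). P x y \<and> x < y \<and> y < x + p}" using that(1) by simp
      then have "x \<in> fst ` {(x, y). P x y \<and> x < y \<and> y < x + p}" by (rule image_eqI[rotated]) simp
      then show ?thesis using b0 by blast
    qed (use b0 that(1) in blast)
    then show False using that(2) by simp
  qed
  show ?thesis
  proof (rule half_of_partition[OF sm])
    fix t :: int assume t: "t > int (max K b)"
    define x where "x = nat t"
    have x: "t = int x" "K \<le> x" "b \<le> x" using t by (auto simp: x_def)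
    obtain y where y: "P x y" using col_exists x(2) by blast
    have unique: "y' = y" if "P x y'" for y' using col_unique[OF that y x(2)] .
    have 1: "(\<exists>n\<ge>int p. int (\<alpha> (nat n)) = t) \<longleftrightarrow> x + p \<le> y"
    proof
      assume "\<exists>n\<ge>int p. int (\<alpha> (nat n)) = t"
      then obtain n where n: "n \<ge> int p" "x = \<alpha> (nat n)" using x(1) by auto
      then have "P x (x + nat n)" using P_upper[of "nat n" x] by auto
      then show "x + p \<le> y" using unique[of "x + nat n"] n by auto
    next
      assume le: "x + p \<le> y"
      define n where "n = y - x"
      have n: "p \<le> n" "y = x + n" using le by (auto simp: n_def)
      then have "x = \<alpha> n" using P_upper[of n x] y by simp
      then show "\<exists>n\<ge>int p. int (\<alpha> (nat n)) = t"
        using n x(1) by (intro exI[of _ "int n"]) simp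
    qed
    have 2: "(\<exists>n\<ge>int q. int (\<beta> (nat n)) + n = t) \<longleftrightarrow> y + q \<le> x"
    proof
      assume "\<exists>n\<ge>int q. int (\<beta> (nat n)) + n = t"
      then obtain n where n: "n \<ge> int q" "x = \<beta> (nat n) + nat n" using x(1) by auto
      then have "P x (\<beta> (nat n))" using P_lower[of "nat n" "\<beta> (nat n)"] by auto
      then show "y + q \<le> x" using unique[of "\<beta> (nat n)"] n by auto
    next
      assume le: "y + q \<le> x"
      define n where "n = x - y"
      have n: "q \<le> n" "x = y + n" using le by (auto simp: n_def)
      then have "y = \<beta> n" using P_lower[of n y] y by simp
      then show "\<exists>n\<ge>int q. int (\<beta> (nat n)) + n = t"
        using n x(1) by (intro exI[of _ "int n"]) simp
    qed
    show "(\<exists>n\<ge>int p. int (\<alpha> (nat n)) = t) \<longleftrightarrow> \<not> (\<exists>n\<ge>int q. int (\<beta> (nat n)) + n = t)"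
      unfolding 1 2 using b[OF y x(3)] pq by linarith
  qed
qed

end

section \<open>From positions to staircases\<close>

lemma staircase_exists:
  assumes "eventually_wythoff P K"
  shows "\<exists>r s. staircase {(int x, int y) | x y. P x y} r s"
proof -
  note swap = eventually_wythoff_swap[OF assms]
  obtain p \<alpha> where \<alpha>: "diag_enum P p \<alpha>" using diag_enum_exists[OF assms] by blast
  obtain q \<beta> where \<beta>: "diag_enum (\<lambda>x y. P y x) q \<beta>" using diag_enum_exists[OF swap] by blast
  let ?a = "\<lambda>n. int (\<alpha> (nat n))" and ?c = "\<lambda>n. int (\<beta> (nat n))"
  from half_exists[OF assms \<alpha> \<beta>] obtain r where r: "half ?a ?c (int p) (int q) r" by blast
  \<comment> \<open>For the transposed predicate the statement on columns becomes the one on rows,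
    which supplies the constant of the second coordinates.\<close>
  from half_exists[OF swap \<beta> \<alpha>] obtain s where s: "half ?c ?a (int q) (int p) s" by blast
  have P_upper: "P x (x + n) \<longleftrightarrow> x = \<alpha> n" if "p \<le> n" for x n
    using \<alpha> that by (auto simp: diag_enum_def)
  have P_lower: "P (x + n) x \<longleftrightarrow> x = \<beta> n" if "q \<le> n" for x n
    using \<beta> that by (auto simp: diag_enum_def)
  \<comment> \<open>These are the positions that neither enumeration reaches, including the main
    diagonal; they form the finite exceptional set.\<close>
  define F where "F = {(x, y). P x y \<and> x < y \<and> y < x + p} \<union>
     prod.swap ` {(y, x). P x y \<and> y < x \<and> x < y + q} \<union> (\<lambda>x. (x, x)) ` {x. P x x}"
  have "finite {x. P x x}" by (rule finite_subset[OF _ finite_small_diag[OF assms, of 0]]) auto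
  then have finF: "finite F" using \<alpha> \<beta> by (simp add: F_def diag_enum_def)
  let ?E = "(\<lambda>(x, y). (int x, int y)) ` F"
  have "{(int x, int y) | x y. P x y} = ?E \<union> upper_pts ?a (int p) \<union> lower_pts ?c (int q)"
  proof (intro equalityI subsetI)
    fix z assume "z \<in> {(int x, int y) | x y. P x y}"
    then obtain x y where z: "z = (int x, int y)" "P x y" by auto
    consider "x + p \<le> y" | "y + q \<le> x" | "x < y" "y < x + p" | "y < x" "x < y + q" | "x = y"
      by linarith
    then show "z \<in> ?E \<union> upper_pts ?a (int p) \<union> lower_pts ?c (int q)"
    proof cases
      case 1
      define n where "n = y - x"
      have n: "p \<le> n" "y = x + n" using 1 by (auto simp: n_def)
      then have "x = \<alpha> n" using P_upper[of n x] z by simp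
      then have "z \<in> upper_pts ?a (int p)"
        unfolding upper_pts_def using n z(1) by (intro image_eqI[of _ _ "int n"]) simp_all
      then show ?thesis by blast
    next
      case 2
      define n where "n = x - y"
      have n: "q \<le> n" "x = y + n" using 2 by (auto simp: n_def)
      then have "y = \<beta> n" using P_lower[of n y] z by simp
      then have "z \<in> lower_pts ?c (int q)"
        unfolding lower_pts_def using n z(1) by (intro image_eqI[of _ _ "int n"]) simp_all
      then show ?thesis by blast
    next
      case 3
      then have "(x, y) \<in> F" using z by (auto simp: F_def)
      then show ?thesis using z by force
    next
      case 4
      then have "(x, y) \<in> F" using z unfolding F_def by (intro UnI1 UnI2 image_eqI[of _ _ "(y, x)"]) auto
      then show ?thesis using z by force
    next
      case 5
      then have "(x, y) \<in> F" using z by (auto simp: F_def)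
      then show ?thesis using z by force
    qed
  next
    fix z assume "z \<in> ?E \<union> upper_pts ?a (int p) \<union> lower_pts ?c (int q)"
    then consider "z \<in> ?E" | "z \<in> upper_pts ?a (int p)" | "z \<in> lower_pts ?c (int q)" by blast
    then show "z \<in> {(int x, int y) | x y. P x y}"
    proof cases
      case 1
      then show ?thesis by (auto simp: F_def)
    next
      case 2
      then obtain n where n: "int p \<le> n" "z = (?a n, ?a n + n)" by (auto simp: upper_pts_def)
      then have "P (\<alpha> (nat n)) (\<alpha> (nat n) + nat n)" "z = (int (\<alpha> (nat n)), int (\<alpha> (nat n) + nat n))"
        using P_upper[of "nat n"] by auto
      then show ?thesis by blast
    next
      case 3
      then obtain n where n: "int q \<le> n" "z = (?c n + n, ?c n)" by (auto simp: lower_pts_def)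
      then have "P (\<beta> (nat n) + nat n) (\<beta> (nat n))" "z = (int (\<beta> (nat n) + nat n), int (\<beta> (nat n)))"
        using P_lower[of "nat n"] by auto
      then show ?thesis by blast
    qed
  qed
  then show ?thesis unfolding staircase_def using finF r s by blast
qed

lemma eventually_wythoff_labelled_P:
  assumes "finite \<P>" "finite \<N>"
  shows "\<exists>K. eventually_wythoff (\<lambda>x y. labelled_P \<P> \<N> (x, y)) K"
proof -
  have "finite (fst ` (\<P> \<union> \<N>))" "finite (snd ` (\<P> \<union> \<N>))" using assms by simp_all
  then obtain K1 K2 where "\<forall>x \<in> fst ` (\<P> \<union> \<N>). x < K1" "\<forall>y \<in> snd ` (\<P> \<union> \<N>). y < K2"
    unfolding finite_nat_set_iff_bounded by blast
  then have K12: "fst z < K1" "snd z < K2" if "z \<in> \<P> \<union> \<N>" for z using that by blast+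
  define K where "K = max K1 K2"
  have K: "x < K \<and> y < K" if "(x, y) \<in> \<P> \<union> \<N>" for x y
    using K12[OF that] by (simp add: K_def less_max_iff_disj)
  have "eventually_wythoff (\<lambda>x y. labelled_P \<P> \<N> (x, y)) K"
    unfolding eventually_wythoff_def
  proof (intro allI impI)
    fix x y assume "K \<le> x \<or> K \<le> y"
    then have "(x, y) \<notin> \<P> \<union> \<N>" using K[of x y] by linarith
    then have "labelled_P \<P> \<N> (x, y) \<longleftrightarrow> (\<forall>q. wythoff_move (x, y) q \<longrightarrow> \<not> labelled_P \<P> \<N> q)"
      by (subst labelled_P.simps) auto
    then show "labelled_P \<P> \<N> (x, y) \<longleftrightarrow>
        (\<forall>k\<ge>1. (k \<le> x \<longrightarrow> \<not> labelled_P \<P> \<N> (x - k, y)) \<and> (k \<le> y \<longrightarrow> \<not> labelled_P \<P> \<N> (x, y - k)) \<and>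
          (k \<le> x \<and> k \<le> y \<longrightarrow> \<not> labelled_P \<P> \<N> (x - k, y - k)))"
      unfolding wythoff_move_def by blast
  qed
  then show ?thesis ..
qed

lemma staircase_P_positions:
  assumes "finite \<P>" "finite \<N>"
  shows "\<exists>r s. staircase (P_positions \<P> \<N>) r s"
proof -
  obtain K where "eventually_wythoff (\<lambda>x y. labelled_P \<P> \<N> (x, y)) K"
    using eventually_wythoff_labelled_P[OF assms] by blast
  from staircase_exists[OF this] show ?thesis by (simp add: P_positions_def)
qed

theorem theorem1:
  fixes \<P> \<N> :: "(nat \<times> nat) set"
  assumes "finite \<P>" and "finite \<N>" and "\<P> \<inter> \<N> = {}"
  shows "\<exists>!d :: int \<times> int.
           asymptotically_equal (translate (P_positions \<P> \<N>) d) (P_positions {} {})"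
  using staircase_P_positions[OF assms(1,2)] staircase_P_positions[of "{}" "{}"]
    staircase_unique_translation by blast

end
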